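(* Let $\overline L=f(e^{\sigma}L,\beta)$ be a generalized $\beta$-conformal change of a Finsler space $(M,L)$ of dimension $n>2$. Then the following two assertions are equivalent: (a) the b-condition is invariant under the generalized $\beta$-conformal change; (b) the generalized $\beta$-conformal change is an energy $\beta$-change.
   Context: $(M,L)$ is an $n$-dimensional $C^\infty$ Finsler manifold; $\dot\partial_i=\partial/\partial y^i$, $g_{ij}=\frac12\dot\partial_i\dot\partial_jL^2$, $y_i=g_{ij}y^j$, and $C_{ijk}=\frac12\dot\partial_kg_{ij}$ is the Cartan tensor. A generalized $\beta$-conformal change is $L\mapsto\overline{L}=f(\widetilde L,\beta)$ with $\widetilde L=e^{\sigma(x)}L$, $\sigma$ a function on $M$, $\beta=b_i(x)y^i$ given by a 1-form on $M$, and $f$ positively homogeneous of degree one in $(\widetilde L,\beta)$; it is assumed that $(M,\overline L)$ is a Finsler space, with Cartan tensor $\overline C_{ijk}$. Notation: $b^i=g^{ij}b_j$, $m_i=b_i-(\beta/L^2)y_i$, $m^2=g^{ij}m_im_j$. Standing assumptions: $m_i\ne0$, $m^2\neq0$, and $e^{\sigma}p+m^2ff_{22}\neq0$, where $p=ff_1/L$, $f_1=\partial f/\partial\widetilde L$, $f_{22}=\partial^2f/\partial\beta^2$. $(M,L)$ satisfies the b-condition if $b^iC_{ijk}=0$. Invariance of the b-condition means that from $b^iC_{ijk}=0$ for $(M,L)$ one obtains $b^i\overline C_{ijk}=0$ for $(M,\overline L)$. The change is called an energy $\beta$-change if $\overline L=(k'e^{2\sigma}L^2+k\beta^2)^{1/2}$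 with nonzero constants $k,k'$.
   Formalization: It is additionally assumed that M is connected, that (M,L) itself satisfies the b-condition (otherwise (a) is vacuous), and that ∂f/∂β is nonzero somewhere along the change (the conformal change f = e^σ L satisfies (a) but not (b)); L lives on a conic domain with connected fibres. *)

theory Defs
  imports "HOL-Analysis.Analysis"
begin

section \<open>Smooth maps and smooth manifolds\<close>

(* To be used on open sets S only: the derivatives are two-sided. *)
primrec Ck_on :: "nat \<Rightarrow> ('a::euclidean_space \<Rightarrow> 'b::euclidean_space) \<Rightarrow> 'a set \<Rightarrow> bool" where
  "Ck_on 0 F S \<longleftrightarrow> continuous_on S F"
| "Ck_on (Suc k) F S \<longleftrightarrow>
     (\<forall>x\<in>S. F differentiable (at x)) \<and>
     (\<forall>v. Ck_on k (\<lambda>x. frechet_derivative F (at x) v) S)"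

definition smooth_on :: "('a::euclidean_space \<Rightarrow> 'b::euclidean_space) \<Rightarrow> 'a set \<Rightarrow> bool" where
  "smooth_on F S \<longleftrightarrow> (\<forall>k. Ck_on k F S)"

(* A chart is a pair (U, phi); phi is relevant on U only. *)
type_synonym ('a, 'n) chart = "'a set \<times> ('a \<Rightarrow> real ^ 'n)"

abbreviation chart_dom :: "('a, 'n) chart \<Rightarrow> 'a set" where
  "chart_dom c \<equiv> fst c"

abbreviation chart_img :: "('a, 'n::finite) chart \<Rightarrow> (real ^ 'n) set" where
  "chart_img c \<equiv> snd c ` fst c"

definition chart_inv :: "('a, 'n) chart \<Rightarrow> real ^ 'n \<Rightarrow> 'a" where
  "chart_inv c = inv_into (fst c) (snd c)"

definition transition :: "('a, 'n) chart \<Rightarrow> ('a, 'n) chart \<Rightarrow> real ^ 'n \<Rightarrow> real ^ 'n" where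
  "transition c d = snd d \<circ> chart_inv c"

definition smooth_manifold :: "'a topology \<Rightarrow> ('a, 'n::finite) chart set \<Rightarrow> bool" where
  "smooth_manifold X A \<longleftrightarrow>
     Hausdorff_space X \<and> second_countable X \<and>
     (\<Union>c\<in>A. chart_dom c) = topspace X \<and>
     (\<forall>c\<in>A. openin X (chart_dom c) \<and> open (chart_img c) \<and>
        homeomorphic_map (subtopology X (chart_dom c)) (top_of_set (chart_img c)) (snd c)) \<and>
     (\<forall>c\<in>A. \<forall>d\<in>A. smooth_on (transition c d) (snd c ` (chart_dom c \<inter> chart_dom d)))"

(* Coordinates, in the chart d, of the tangent vector at p whose coordinates in c are y. *)
definition push :: "('a, 'n::finite) chart \<Rightarrow> ('a, 'n) chart \<Rightarrow> 'a \<Rightarrow> real ^ 'n \<Rightarrow> real ^ 'n" where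
  "push c d p y = frechet_derivative (transition c d) (at (snd c p)) y"

section \<open>Objects on a manifold and on its tangent bundle\<close>

text \<open>
  Objects involving tangent vectors are given by their local expressions in the charts
  of the atlas, subject to the usual transformation law on overlaps; \<open>(x, y)\<close> are the
  induced coordinates on the tangent bundle.
\<close>

definition smooth_function ::
  "('a, 'n::finite) chart set \<Rightarrow> ('a \<Rightarrow> real) \<Rightarrow> bool" where
  "smooth_function A s \<longleftrightarrow> (\<forall>c\<in>A. smooth_on (s \<circ> chart_inv c) (chart_img c))"

definition one_form ::
  "('a, 'n::finite) chart set \<Rightarrow> (('a, 'n) chart \<Rightarrow> real ^ 'n \<Rightarrow> real ^ 'n) \<Rightarrow> bool" where
  "one_form A b \<longleftrightarrow>
     (\<forall>c\<in>A. smooth_on (b c) (chart_img c)) \<and>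
     (\<forall>c\<in>A. \<forall>d\<in>A. \<forall>p \<in> chart_dom c \<inter> chart_dom d. \<forall>y.
        b d (snd d p) \<bullet> push c d p y = b c (snd c p) \<bullet> y)"

(* An open subset of the slit tangent bundle whose fibre over every point of M is a
   nonempty connected cone.  The whole slit tangent bundle is one (in dimension > 1), but
   proper cones are needed as well: if L is positive definite on all nonzero vectors, the
   covector m_i vanishes on the ray where beta/L attains its maximum over the fibre, so
   the condition m_i ~= 0 can only hold on a smaller conic domain. *)
definition conic_domain ::
  "('a, 'n::finite) chart set \<Rightarrow> (('a, 'n) chart \<Rightarrow> ((real ^ 'n) \<times> (real ^ 'n)) set) \<Rightarrow> bool" where
  "conic_domain A D \<longleftrightarrow>
     (\<forall>c\<in>A. open (D c) \<and> D c \<subseteq> chart_img c \<times> (UNIV - {0}) \<and>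
        (\<forall>x y. \<forall>t>0. (x, y) \<in> D c \<longrightarrow> (x, t *\<^sub>R y) \<in> D c) \<and>
        (\<forall>x\<in>chart_img c. {y. (x, y) \<in> D c} \<noteq> {} \<and> connected {y. (x, y) \<in> D c})) \<and>
     (\<forall>c\<in>A. \<forall>d\<in>A. \<forall>p \<in> chart_dom c \<inter> chart_dom d. \<forall>y.
        (snd d p, push c d p y) \<in> D d \<longleftrightarrow> (snd c p, y) \<in> D c)"

section \<open>Finsler structures\<close>

(* The partial derivative with respect to the i-th coordinate. *)
definition pd :: "'n \<Rightarrow> (real ^ 'n \<Rightarrow> real) \<Rightarrow> real ^ 'n::finite \<Rightarrow> real" where
  "pd i F y = frechet_derivative F (at y) (axis i 1)"

text \<open>
  In this section \<open>L x y\<close> is the local expression of a function on the tangent bundle in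
  one fixed chart, and \<open>b\<close> a covector at \<open>x\<close>.
\<close>

definition metric_tensor ::
  "(real ^ 'n \<Rightarrow> real ^ 'n \<Rightarrow> real) \<Rightarrow> real ^ 'n \<Rightarrow> real ^ 'n \<Rightarrow> real ^ 'n::finite ^ 'n" where
  "metric_tensor L x y = (\<chi> i j. 1/2 * pd i (pd j (\<lambda>z. (L x z)\<^sup>2)) y)"

definition cartan_tensor ::
  "(real ^ 'n \<Rightarrow> real ^ 'n \<Rightarrow> real) \<Rightarrow> real ^ 'n \<Rightarrow> real ^ 'n::finite \<Rightarrow> 'n \<Rightarrow> 'n \<Rightarrow> 'n \<Rightarrow> real" where
  "cartan_tensor L x y i j k = 1/2 * pd k (\<lambda>z. metric_tensor L x z $ i $ j) y"

definition inverse_metric ::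
  "(real ^ 'n \<Rightarrow> real ^ 'n \<Rightarrow> real) \<Rightarrow> real ^ 'n \<Rightarrow> real ^ 'n \<Rightarrow> real ^ 'n::finite ^ 'n" where
  "inverse_metric L x y = matrix_inv (metric_tensor L x y)"

definition y_low ::
  "(real ^ 'n \<Rightarrow> real ^ 'n \<Rightarrow> real) \<Rightarrow> real ^ 'n \<Rightarrow> real ^ 'n \<Rightarrow> real ^ 'n::finite" where
  "y_low L x y = (\<chi> i. \<Sum>j\<in>UNIV. metric_tensor L x y $ i $ j * y $ j)"

definition b_up ::
  "(real ^ 'n \<Rightarrow> real ^ 'n \<Rightarrow> real) \<Rightarrow> real ^ 'n \<Rightarrow> real ^ 'n \<Rightarrow> real ^ 'n \<Rightarrow> real ^ 'n::finite" where
  "b_up L b x y = (\<chi> i. \<Sum>j\<in>UNIV. inverse_metric L x y $ i $ j * b $ j)"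

definition m_low ::
  "(real ^ 'n \<Rightarrow> real ^ 'n \<Rightarrow> real) \<Rightarrow> real ^ 'n \<Rightarrow> real ^ 'n \<Rightarrow> real ^ 'n \<Rightarrow> real ^ 'n::finite" where
  "m_low L b x y = (\<chi> i. b $ i - (b \<bullet> y) / (L x y)\<^sup>2 * y_low L x y $ i)"

definition m_sq ::
  "(real ^ 'n \<Rightarrow> real ^ 'n \<Rightarrow> real) \<Rightarrow> real ^ 'n::finite \<Rightarrow> real ^ 'n \<Rightarrow> real ^ 'n \<Rightarrow> real" where
  "m_sq L b x y =
     (\<Sum>i\<in>UNIV. \<Sum>j\<in>UNIV. inverse_metric L x y $ i $ j * m_low L b x y $ i * m_low L b x y $ j)"

(* The metric tensor is required to be nondegenerate, not necessarily positive definite. *)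
definition finsler_structure ::
  "('a, 'n::finite) chart set \<Rightarrow> (('a, 'n) chart \<Rightarrow> ((real ^ 'n) \<times> (real ^ 'n)) set) \<Rightarrow>
   (('a, 'n) chart \<Rightarrow> real ^ 'n \<Rightarrow> real ^ 'n \<Rightarrow> real) \<Rightarrow> bool" where
  "finsler_structure A D L \<longleftrightarrow>
     (\<forall>c\<in>A. smooth_on (\<lambda>(x, y). L c x y) (D c) \<and>
        (\<forall>(x, y)\<in>D c. L c x y > 0 \<and>
           (\<forall>t>0. L c x (t *\<^sub>R y) = t * L c x y) \<and>
           invertible (metric_tensor (L c) x y))) \<and>
     (\<forall>c\<in>A. \<forall>d\<in>A. \<forall>p \<in> chart_dom c \<inter> chart_dom d. \<forall>y.
        (snd c p, y) \<in> D c \<longrightarrow> L d (snd d p) (push c d p y) = L c (snd c p) y)"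

section \<open>Generalized \<open>\<beta>\<close>-conformal changes and the b-condition\<close>

definition pd1 :: "(real \<Rightarrow> real \<Rightarrow> real) \<Rightarrow> real \<Rightarrow> real \<Rightarrow> real" where
  "pd1 f u v = deriv (\<lambda>t. f t v) u"

definition pd2 :: "(real \<Rightarrow> real \<Rightarrow> real) \<Rightarrow> real \<Rightarrow> real \<Rightarrow> real" where
  "pd2 f u v = deriv (\<lambda>t. f u t) v"

definition L_tilde ::
  "('a \<Rightarrow> real) \<Rightarrow> (('a, 'n::finite) chart \<Rightarrow> real ^ 'n \<Rightarrow> real ^ 'n \<Rightarrow> real) \<Rightarrow>
   ('a, 'n) chart \<Rightarrow> real ^ 'n \<Rightarrow> real ^ 'n \<Rightarrow> real" where
  "L_tilde \<sigma> L c x y = exp (\<sigma> (chart_inv c x)) * L c x y"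

definition beta ::
  "(('a, 'n::finite) chart \<Rightarrow> real ^ 'n \<Rightarrow> real ^ 'n) \<Rightarrow>
   ('a, 'n) chart \<Rightarrow> real ^ 'n \<Rightarrow> real ^ 'n \<Rightarrow> real" where
  "beta b c x y = b c x \<bullet> y"

definition L_bar ::
  "(real \<Rightarrow> real \<Rightarrow> real) \<Rightarrow> ('a \<Rightarrow> real) \<Rightarrow>
   (('a, 'n::finite) chart \<Rightarrow> real ^ 'n \<Rightarrow> real ^ 'n) \<Rightarrow>
   (('a, 'n) chart \<Rightarrow> real ^ 'n \<Rightarrow> real ^ 'n \<Rightarrow> real) \<Rightarrow>
   ('a, 'n) chart \<Rightarrow> real ^ 'n \<Rightarrow> real ^ 'n \<Rightarrow> real" where
  "L_bar f \<sigma> b L c x y = f (L_tilde \<sigma> L c x y) (beta b c x y)"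

(* W is the domain of f: an open cone in the plane containing all values of (L~, beta). *)
definition generalized_beta_conformal_change ::
  "('a, 'n::finite) chart set \<Rightarrow> (('a, 'n) chart \<Rightarrow> ((real ^ 'n) \<times> (real ^ 'n)) set) \<Rightarrow>
   (('a, 'n) chart \<Rightarrow> real ^ 'n \<Rightarrow> real ^ 'n \<Rightarrow> real) \<Rightarrow>
   (real \<Rightarrow> real \<Rightarrow> real) \<Rightarrow> (real \<times> real) set \<Rightarrow> ('a \<Rightarrow> real) \<Rightarrow>
   (('a, 'n) chart \<Rightarrow> real ^ 'n \<Rightarrow> real ^ 'n) \<Rightarrow> bool" where
  "generalized_beta_conformal_change A D L f W \<sigma> b \<longleftrightarrow>
     smooth_function A \<sigma> \<and> one_form A b \<and>
     open W \<and> smooth_on (\<lambda>(u, v). f u v) W \<and>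
     (\<forall>(u, v)\<in>W. \<forall>t>0. (t * u, t * v) \<in> W \<and> f (t * u) (t * v) = t * f u v) \<and>
     (\<forall>c\<in>A. \<forall>(x, y)\<in>D c. (L_tilde \<sigma> L c x y, beta b c x y) \<in> W) \<and>
     finsler_structure A D (L_bar f \<sigma> b L)"

(* The last condition is  e^sigma p + m^2 f f_22 ~= 0  with  p = f f_1 / L. *)
definition standing_assumptions ::
  "('a, 'n::finite) chart set \<Rightarrow> (('a, 'n) chart \<Rightarrow> ((real ^ 'n) \<times> (real ^ 'n)) set) \<Rightarrow>
   (('a, 'n) chart \<Rightarrow> real ^ 'n \<Rightarrow> real ^ 'n \<Rightarrow> real) \<Rightarrow>
   (real \<Rightarrow> real \<Rightarrow> real) \<Rightarrow> ('a \<Rightarrow> real) \<Rightarrow>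
   (('a, 'n) chart \<Rightarrow> real ^ 'n \<Rightarrow> real ^ 'n) \<Rightarrow> bool" where
  "standing_assumptions A D L f \<sigma> b \<longleftrightarrow>
     (\<forall>c\<in>A. \<forall>(x, y)\<in>D c.
        let u = L_tilde \<sigma> L c x y; v = beta b c x y; p = f u v * pd1 f u v / L c x y
        in m_low (L c) (b c x) x y \<noteq> 0 \<and> m_sq (L c) (b c x) x y \<noteq> 0 \<and>
           exp (\<sigma> (chart_inv c x)) * p
             + m_sq (L c) (b c x) x y * (f u v * pd2 (pd2 f) u v) \<noteq> 0)"

(* b^i C'_ijk = 0, where C' is the Cartan tensor of L' and the index of b is raised with
   the metric of L.  The b-condition for (M, L) is the case L' = L; for the changed space
   L' = L_bar, and b^i is still g^ij b_j with the original metric. *)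
definition b_condition ::
  "('a, 'n::finite) chart set \<Rightarrow> (('a, 'n) chart \<Rightarrow> ((real ^ 'n) \<times> (real ^ 'n)) set) \<Rightarrow>
   (('a, 'n) chart \<Rightarrow> real ^ 'n \<Rightarrow> real ^ 'n) \<Rightarrow>
   (('a, 'n) chart \<Rightarrow> real ^ 'n \<Rightarrow> real ^ 'n \<Rightarrow> real) \<Rightarrow>
   (('a, 'n) chart \<Rightarrow> real ^ 'n \<Rightarrow> real ^ 'n \<Rightarrow> real) \<Rightarrow> bool" where
  "b_condition A D b L L' \<longleftrightarrow>
     (\<forall>c\<in>A. \<forall>(x, y)\<in>D c. \<forall>j k.
        (\<Sum>i\<in>UNIV. b_up (L c) (b c x) x y $ i * cartan_tensor (L' c) x y i j k) = 0)"

definition b_condition_invariant ::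
  "('a, 'n::finite) chart set \<Rightarrow> (('a, 'n) chart \<Rightarrow> ((real ^ 'n) \<times> (real ^ 'n)) set) \<Rightarrow>
   (('a, 'n) chart \<Rightarrow> real ^ 'n \<Rightarrow> real ^ 'n \<Rightarrow> real) \<Rightarrow>
   (real \<Rightarrow> real \<Rightarrow> real) \<Rightarrow> ('a \<Rightarrow> real) \<Rightarrow>
   (('a, 'n) chart \<Rightarrow> real ^ 'n \<Rightarrow> real ^ 'n) \<Rightarrow> bool" where
  "b_condition_invariant A D L f \<sigma> b \<longleftrightarrow>
     (b_condition A D b L L \<longrightarrow> b_condition A D b L (L_bar f \<sigma> b L))"

definition energy_beta_change ::
  "('a, 'n::finite) chart set \<Rightarrow> (('a, 'n) chart \<Rightarrow> ((real ^ 'n) \<times> (real ^ 'n)) set) \<Rightarrow>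
   (('a, 'n) chart \<Rightarrow> real ^ 'n \<Rightarrow> real ^ 'n \<Rightarrow> real) \<Rightarrow>
   (real \<Rightarrow> real \<Rightarrow> real) \<Rightarrow> ('a \<Rightarrow> real) \<Rightarrow>
   (('a, 'n) chart \<Rightarrow> real ^ 'n \<Rightarrow> real ^ 'n) \<Rightarrow> bool" where
  "energy_beta_change A D L f \<sigma> b \<longleftrightarrow>
     (\<exists>k k'. k \<noteq> 0 \<and> k' \<noteq> 0 \<and>
        (\<forall>c\<in>A. \<forall>(x, y)\<in>D c.
           L_bar f \<sigma> b L c x y
             = sqrt (k' * exp (2 * \<sigma> (chart_inv c x)) * (L c x y)\<^sup>2 + k * (beta b c x y)\<^sup>2)))"

end

theory Submission
  imports Defs
begin

text \<open>
  Write \<open>s = \<beta> / (e\<^sup>\<sigma> L)\<close> for the ratio of the two arguments of \<open>f\<close> (\<open>ratio\<close> below).  By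
  homogeneity \<open>L'\<^sup>2 = e\<^sup>2\<^sup>\<sigma> L\<^sup>2 \<psi>(s)\<close> for the changed function \<open>L'\<close>, with the profile
  \<open>\<psi>(r) = f(1,r)\<^sup>2\<close> of one real variable, and an energy change is one with
  \<open>\<psi>(r) = k' + k r\<^sup>2\<close>.

  If \<open>\<psi>\<close> has this form, then \<open>L'\<^sup>2\<close> differs from \<open>k' e\<^sup>2\<^sup>\<sigma> L\<^sup>2\<close> on each fibre by a quadratic
  form, which third derivatives do not see.  So the new Cartan tensor is a multiple of the old
  one, and the b-condition survives (\<open>metric_and_cartan_of_quadratic_sum\<close>).

  For the converse fix a point \<open>(x, y)\<close>, let \<open>B\<close> be the vector \<open>b\<^sup>i\<close>, and choose a vector
  \<open>Y \<noteq> 0\<close> that is annihilated by \<open>b\<close> and by the differential of \<open>L\<^sup>2\<close> at \<open>y\<close>; this needs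
  dimension greater than two.  Since \<open>\<beta>\<close> is constant in the direction \<open>Y\<close>, differentiating
  in this direction gives, near \<open>y\<close>,
  \<open>D\<^sub>Y L'\<^sup>2 = e\<^sup>2\<^sup>\<sigma> \<chi>(s) D\<^sub>Y L\<^sup>2\<close> with \<open>\<chi> = \<psi> - r \<psi>' / 2\<close>.
  Differentiate once more along \<open>B\<close> and along a coordinate vector \<open>e\<^sub>k\<close>.  At \<open>y\<close> the
  function \<open>D\<^sub>Y L\<^sup>2\<close> vanishes by the choice of \<open>Y\<close>, its derivative along \<open>B\<close> is
  \<open>2 g(B, Y) = 2 b(Y) = 0\<close>, and its second derivative along \<open>B\<close> and \<open>e\<^sub>k\<close> is zero by the
  b-condition for \<open>L\<close>.  The b-condition for \<open>L'\<close> thus leaves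
  \<open>\<chi>'(s) D\<^sub>B s g(Y, e\<^sub>k) = 0\<close>.  Here \<open>D\<^sub>B s = m\<^sup>2 / (e\<^sup>\<sigma> L) \<noteq> 0\<close>, and some \<open>g(Y, e\<^sub>k)\<close> is nonzero
  because \<open>g\<close> is nondegenerate.  Hence \<open>\<psi>' = r \<psi>''\<close> at every value of \<open>s\<close>
  (\<open>changed_b_condition_forces_ode\<close>).

  The set of all values of \<open>s\<close> is open, because \<open>D\<^sub>B s \<noteq> 0\<close>, and connected, because \<open>M\<close> and
  the fibres of the conic domain are.  On an open interval the equation \<open>\<psi>' = r \<psi>''\<close> forces
  \<open>\<psi>\<close> to be \<open>k' + k r\<^sup>2\<close> with the same constants on both sides of zero (\<open>ode_quadratic\<close>).
  Finally \<open>k \<noteq> 0\<close> because \<open>f\<close> depends on \<open>\<beta>\<close>, and \<open>k' \<noteq> 0\<close> because the metric tensor of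
  \<open>k \<beta>\<^sup>2\<close> has rank at most one.
\<close>

section \<open>Derivatives and classes of differentiability\<close>

abbreviation dd :: "'a \<Rightarrow> ('a::euclidean_space \<Rightarrow> 'b::euclidean_space) \<Rightarrow> 'a \<Rightarrow> 'b" where
  "dd v F z \<equiv> frechet_derivative F (at z) v"

lemma dd_eqI: "(F has_derivative F') (at z) \<Longrightarrow> dd v F z = F' v"
  by (metis frechet_derivative_at)

text \<open>
  Derivatives depend on germs only.  This is used to rewrite inside iterated derivatives, whose
  existence is a separate matter.
\<close>

lemma dd_cong:
  assumes "open S" "z \<in> S" "\<And>w. w \<in> S \<Longrightarrow> F w = G w"
  shows "dd v F z = dd v G z"
proof -
  have "(F has_derivative F') (at z) \<longleftrightarrow> (G has_derivative F') (at z)" for F'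
    using has_derivative_transform_within_open[OF _ assms(1,2)] assms(3) by metis
  then show ?thesis
    unfolding frechet_derivative_def by presburger
qed

lemma differentiable_cong_open:
  assumes "open S" "z \<in> S" "\<And>w. w \<in> S \<Longrightarrow> F w = G w" "F differentiable (at z)"
  shows "G differentiable (at z)"
  using assms has_derivative_transform_within_open unfolding differentiable_def by blast

lemma Ck_on_cong:
  assumes "open S" "\<And>w. w \<in> S \<Longrightarrow> F w = G w" "Ck_on k F S"
  shows "Ck_on k G S"
  using assms(2,3)
proof (induction k arbitrary: F G)
  case 0
  then show ?case using continuous_on_cong[of S S F G] by simp
next
  case (Suc k)
  have "Ck_on k (\<lambda>x. dd v G x) S" for v
  proof (rule Suc.IH[of "dd v F"])
    show "dd v F w = dd v G w" if "w \<in> S" for w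
      using dd_cong[OF assms(1) that Suc.prems(1)] .
  qed (use Suc.prems in auto)
  moreover have "\<forall>x\<in>S. G differentiable (at x)"
    using Suc.prems(2) differentiable_cong_open[OF assms(1) _ Suc.prems(1)] by simp
  ultimately show ?case by simp
qed

lemma Ck_on_imp_continuous_on: "Ck_on k F S \<Longrightarrow> continuous_on S F"
  by (cases k) (auto simp: continuous_at_imp_continuous_on differentiable_imp_continuous_within)

lemma Ck_on_SucD: "Ck_on (Suc k) F S \<Longrightarrow> Ck_on k F S"
proof (induction k arbitrary: F)
  case 0
  then show ?case using Ck_on_imp_continuous_on[of "Suc 0" F S] by simp
next
  case (Suc k)
  then show ?case by (metis Ck_on.simps(2))
qed

lemma Ck_on_differentiable: "Ck_on (Suc k) F S \<Longrightarrow> z \<in> S \<Longrightarrow> F differentiable (at z)"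
  by simp

lemma Ck_on_has_derivative:
  "Ck_on (Suc k) F S \<Longrightarrow> z \<in> S \<Longrightarrow> (F has_derivative (\<lambda>v. dd v F z)) (at z)"
  by (metis Ck_on_differentiable frechet_derivative_works)

lemma Ck_on_add:
  assumes "open S" "Ck_on k F S" "Ck_on k G S"
  shows "Ck_on k (\<lambda>x. F x + G x) S"
  using assms(2,3)
proof (induction k arbitrary: F G)
  case 0
  then show ?case by (simp add: continuous_on_add)
next
  case (Suc k)
  have der: "((\<lambda>x. F x + G x) has_derivative (\<lambda>v. dd v F x + dd v G x)) (at x)" if "x \<in> S" for x
    using Suc.prems that by (intro has_derivative_add Ck_on_has_derivative)
  have "Ck_on k (dd v (\<lambda>x. F x + G x)) S" for v
    by (rule Ck_on_cong[OF assms(1) _ Suc.IH[of "dd v F" "dd v G"]])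
       (use Suc.prems dd_eqI[OF der] in auto)
  moreover have "\<forall>x\<in>S. (\<lambda>x. F x + G x) differentiable (at x)"
    using der unfolding differentiable_def by blast
  ultimately show ?case by simp
qed

lemma Ck_on_mult:
  fixes F G :: "'a::euclidean_space \<Rightarrow> real"
  assumes "open S" "Ck_on k F S" "Ck_on k G S"
  shows "Ck_on k (\<lambda>x. F x * G x) S"
  using assms(2,3)
proof (induction k arbitrary: F G)
  case 0
  then show ?case by (simp add: continuous_on_mult)
next
  case (Suc k)
  have der: "((\<lambda>x. F x * G x) has_derivative (\<lambda>v. F x * dd v G x + dd v F x * G x)) (at x)"
    if "x \<in> S" for x
    using Suc.prems that by (intro has_derivative_mult Ck_on_has_derivative)
  have "Ck_on k (dd v (\<lambda>x. F x * G x)) S" for v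
  proof (rule Ck_on_cong[OF assms(1)])
    show "Ck_on k (\<lambda>x. F x * dd v G x + dd v F x * G x) S"
      using Suc.prems Ck_on_SucD by (intro Ck_on_add[OF assms(1)] Suc.IH) auto
  qed (use dd_eqI[OF der] in auto)
  moreover have "\<forall>x\<in>S. (\<lambda>x. F x * G x) differentiable (at x)"
    using der unfolding differentiable_def by blast
  ultimately show ?case by simp
qed

lemma open_slice:
  fixes D :: "('a::topological_space \<times> 'b::topological_space) set"
  assumes "open D"
  shows "open {y. (x, y) \<in> D}"
proof -
  have "{y. (x, y) \<in> D} = Pair x -` D" by auto
  then show ?thesis using assms by (simp add: open_vimage continuous_intros)
qed

text \<open>
  Fixing the first argument keeps the order of differentiability.  It is used twice: for the
  restriction of a Finsler function to a fibre, and for the profile \<open>f(1, -)\<close>.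
\<close>

lemma Ck_on_slice:
  fixes F :: "'a::euclidean_space \<times> 'b::euclidean_space \<Rightarrow> 'c::euclidean_space"
  assumes "open D" "Ck_on k F D"
  shows "Ck_on k (\<lambda>y. F (x, y)) {y. (x, y) \<in> D}"
  using assms(2)
proof (induction k arbitrary: F)
  case 0
  then show ?case by (auto intro!: continuous_on_compose2[of D F] continuous_intros)
next
  case (Suc k)
  have der: "((\<lambda>y. F (x, y)) has_derivative (\<lambda>v. dd (0, v) F (x, y))) (at y)" if "(x, y) \<in> D" for y
    by (rule has_derivative_compose[of "Pair x" "Pair 0" y UNIV F "\<lambda>v. dd v F (x, y)"])
       (auto intro!: derivative_eq_intros Ck_on_has_derivative[OF Suc.prems that])
  have "Ck_on k (dd v (\<lambda>y. F (x, y))) {y. (x, y) \<in> D}" for v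
    by (rule Ck_on_cong[OF open_slice[OF assms(1)] _ Suc.IH[of "dd (0, v) F"]])
       (use Suc.prems dd_eqI[OF der] in auto)
  moreover have "(\<lambda>y. F (x, y)) differentiable (at y)" if "(x, y) \<in> D" for y
    using der[OF that] unfolding differentiable_def by blast
  ultimately show ?case by simp
qed

lemma has_real_derivative_along_line:
  fixes F :: "'a::euclidean_space \<Rightarrow> real"
  assumes "F differentiable (at (a + s *\<^sub>R v))"
  shows "((\<lambda>s. F (a + s *\<^sub>R v)) has_real_derivative dd v F (a + s *\<^sub>R v)) (at s)"
proof -
  have "((\<lambda>s. F (a + s *\<^sub>R v)) has_derivative (\<lambda>h. dd (h *\<^sub>R v) F (a + s *\<^sub>R v))) (at s)"
    using assms
    by (intro has_derivative_compose[of "\<lambda>s. a + s *\<^sub>R v" "\<lambda>h. h *\<^sub>R v" s UNIV F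
            "\<lambda>v'. dd v' F (a + s *\<^sub>R v)"])
       (auto intro!: derivative_eq_intros simp: frechet_derivative_works)
  moreover have "(\<lambda>h. dd (h *\<^sub>R v) F (a + s *\<^sub>R v)) = (*) (dd v F (a + s *\<^sub>R v))"
    using linear_frechet_derivative[OF assms] by (simp add: linear_cmul fun_eq_iff)
  ultimately show ?thesis unfolding has_field_derivative_def by simp
qed

text \<open>
  The difference is symmetric in \<open>v\<close> and \<open>w\<close> although its limit is written with the two
  derivatives in one order; this is what makes second derivatives commute.  Applying the mean
  value theorem first along \<open>v\<close> and then along \<open>w\<close> turns the quotient into a value of the
  second derivative at a nearby point, and that derivative is continuous.
\<close>

lemma mixed_difference_tendsto:
  fixes F :: "'a::euclidean_space \<Rightarrow> real"
  assumes S: "open S" "y \<in> S" and F: "Ck_on 2 F S"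
  shows "((\<lambda>t. (F (y + t *\<^sub>R v + t *\<^sub>R w) - F (y + t *\<^sub>R v) - F (y + t *\<^sub>R w) + F y) / t\<^sup>2)
            \<longlongrightarrow> dd w (dd v F) y) (at_right 0)"
proof (rule tendstoI)
  fix e :: real assume e: "e > 0"
  have F2: "Ck_on (Suc (Suc 0)) F S" using F by (simp add: numeral_2_eq_2)
  have F1: "Ck_on (Suc 0) (dd v F) S" using F2 by simp
  have "continuous_on S (dd w (dd v F))" using F1 by simp
  then obtain d1 where d1: "d1 > 0" "\<And>z. z \<in> S \<Longrightarrow> dist z y < d1 \<Longrightarrow> dist (dd w (dd v F) z) (dd w (dd v F) y) < e"
    using S(2) e unfolding continuous_on_iff by blast
  obtain d2 where d2: "d2 > 0" "ball y d2 \<subseteq> S"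
    using S openE by blast
  define d where "d = min d1 d2"
  define N where "N = norm v + norm w + 1"
  have N: "N > 0" unfolding N_def by (smt (verit) norm_ge_zero)
  have near: "y + s *\<^sub>R v + s' *\<^sub>R w \<in> ball y d" if "0 \<le> s" "s \<le> t" "0 \<le> s'" "s' \<le> t" "t < d / N" for s s' t
  proof -
    have "norm (s *\<^sub>R v + s' *\<^sub>R w) \<le> s * norm v + s' * norm w"
      using that by (metis norm_triangle_ineq norm_scaleR abs_of_nonneg)
    also have "\<dots> \<le> t * norm v + t * norm w"
      using that by (intro add_mono mult_right_mono) auto
    also have "\<dots> \<le> t * N" using that by (simp add: N_def algebra_simps)
    also have "\<dots> < d" using that N by (simp add: field_simps)
    finally show ?thesis
      by (simp only: mem_ball dist_commute[of y]) (simp add: dist_norm add.assoc)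
  qed
  have inS: "z \<in> S" if "z \<in> ball y d" for z using that d2 by (auto simp: d_def)
  have main: "dist ((F (y + t *\<^sub>R v + t *\<^sub>R w) - F (y + t *\<^sub>R v) - F (y + t *\<^sub>R w) + F y) / t\<^sup>2) (dd w (dd v F) y) < e"
    if t: "0 < t" "t < d / N" for t
  proof -
    have "((\<lambda>s. F (y + t *\<^sub>R w + s *\<^sub>R v) - F (y + s *\<^sub>R v)) has_real_derivative
        dd v F (y + t *\<^sub>R w + s *\<^sub>R v) - dd v F (y + s *\<^sub>R v)) (at s)" if "0 \<le> s" "s \<le> t" for s
      using inS[OF near[of s t t]] inS[OF near[of s t 0]] that t Ck_on_differentiable[OF F2]
      by (intro DERIV_diff has_real_derivative_along_line) (auto simp: algebra_simps)
    from MVT2[OF t(1) this] obtain s where s: "0 < s" "s < t"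
      "F (y + t *\<^sub>R w + t *\<^sub>R v) - F (y + t *\<^sub>R v) - (F (y + t *\<^sub>R w) - F y)
        = t * (dd v F (y + t *\<^sub>R w + s *\<^sub>R v) - dd v F (y + s *\<^sub>R v))"
      by auto
    have "((\<lambda>s'. dd v F (y + s *\<^sub>R v + s' *\<^sub>R w)) has_real_derivative
        dd w (dd v F) (y + s *\<^sub>R v + s' *\<^sub>R w)) (at s')" if "0 \<le> s'" "s' \<le> t" for s'
      using inS[OF near[of s t s']] that t s Ck_on_differentiable[OF F1]
      by (intro has_real_derivative_along_line) auto
    from MVT2[OF t(1) this] obtain s' where s': "0 < s'" "s' < t"
      "dd v F (y + s *\<^sub>R v + t *\<^sub>R w) - dd v F (y + s *\<^sub>R v)
        = t * dd w (dd v F) (y + s *\<^sub>R v + s' *\<^sub>R w)"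
      by auto
    have "(F (y + t *\<^sub>R v + t *\<^sub>R w) - F (y + t *\<^sub>R v) - F (y + t *\<^sub>R w) + F y) / t\<^sup>2
        = dd w (dd v F) (y + s *\<^sub>R v + s' *\<^sub>R w)"
      using s(3) s'(3) t(1) by (simp add: power2_eq_square field_simps add_ac)
    then show ?thesis
      using d1(2)[of "y + s *\<^sub>R v + s' *\<^sub>R w"] near[of s t s'] inS s s' t
      by (simp add: d_def dist_commute)
  qed
  show "\<forall>\<^sub>F t in at_right 0. dist ((F (y + t *\<^sub>R v + t *\<^sub>R w) - F (y + t *\<^sub>R v) - F (y + t *\<^sub>R w) + F y) / t\<^sup>2) (dd w (dd v F) y) < e"
    unfolding eventually_at_right_field
    using main d1(1) d2(1) N by (intro exI[of _ "d / N"]) (auto simp: d_def)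
qed

lemma second_derivative_commute:
  fixes F :: "'a::euclidean_space \<Rightarrow> real"
  assumes "open S" "y \<in> S" "Ck_on 2 F S"
  shows "dd w (dd v F) y = dd v (dd w F) y"
proof -
  have "((\<lambda>t. (F (y + t *\<^sub>R v + t *\<^sub>R w) - F (y + t *\<^sub>R v) - F (y + t *\<^sub>R w) + F y) / t\<^sup>2)
            \<longlongrightarrow> dd v (dd w F) y) (at_right 0)"
    using mixed_difference_tendsto[OF assms, of w v]
    by (rule Lim_transform_eventually) (simp add: algebra_simps)
  with mixed_difference_tendsto[OF assms, of v w] show ?thesis
    by (rule tendsto_unique[rotated]) simp
qed

lemma pd_eq_dd: "pd i F = dd (axis i 1) F"
  by (simp add: pd_def fun_eq_iff)

lemma dd_eq_sum_pd:
  assumes "F differentiable (at z)"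
  shows "dd v F z = (\<Sum>i\<in>UNIV. v $ i * pd i F z)"
proof -
  interpret linear "frechet_derivative F (at z)"
    using assms by (rule linear_frechet_derivative)
  have "dd v F z = dd (\<Sum>i\<in>UNIV. (v $ i) *\<^sub>R axis i 1) F z"
    by (metis basis_expansion scalar_mult_eq_scaleR)
  also have "\<dots> = (\<Sum>i\<in>UNIV. v $ i * pd i F z)"
    by (simp add: sum scale pd_def)
  finally show ?thesis .
qed

lemma dd_sum_const:
  fixes F :: "'i \<Rightarrow> 'a::euclidean_space \<Rightarrow> real"
  assumes "\<And>i. i \<in> I \<Longrightarrow> F i differentiable (at z)"
  shows "dd v (\<lambda>z. \<Sum>i\<in>I. a i * F i z) z = (\<Sum>i\<in>I. a i * dd v (F i) z)"
proof -
  have "((\<lambda>z. a i * F i z) has_derivative (\<lambda>v. a i * dd v (F i) z)) (at z)" if "i \<in> I" for i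
    using assms[OF that] by (intro has_derivative_mult_right) (simp add: frechet_derivative_works)
  then show ?thesis by (rule dd_eqI[OF has_derivative_sum])
qed

text \<open>
  Links the coordinate definitions of the tensors with coordinate-free directional derivatives,
  with which the later computations are done.
\<close>

lemma dd_dd_eq_sum_pd:
  assumes "open S" "z \<in> S" "Ck_on 2 P S"
  shows "dd v (dd w P) z = (\<Sum>i\<in>UNIV. \<Sum>j\<in>UNIV. v $ i * w $ j * pd i (pd j P) z)"
proof -
  have P: "Ck_on (Suc (Suc 0)) P S" using assms(3) by (simp add: numeral_2_eq_2)
  have P1: "Ck_on (Suc 0) (dd u P) S" for u using P by simp
  have "pd i (dd w P) z = (\<Sum>j\<in>UNIV. w $ j * pd i (pd j P) z)" for i
  proof -
    have "pd i (dd w P) z = pd i (\<lambda>z. \<Sum>j\<in>UNIV. w $ j * pd j P z) z"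
      unfolding pd_eq_dd[of i]
      by (rule dd_cong[OF assms(1,2)]) (rule dd_eq_sum_pd[OF Ck_on_differentiable[OF P]])
    also have "\<dots> = (\<Sum>j\<in>UNIV. w $ j * pd i (pd j P) z)"
      unfolding pd_eq_dd by (rule dd_sum_const) (rule Ck_on_differentiable[OF P1 assms(2)])
    finally show ?thesis .
  qed
  then have "dd v (dd w P) z = (\<Sum>i\<in>UNIV. v $ i * (\<Sum>j\<in>UNIV. w $ j * pd i (pd j P) z))"
    using dd_eq_sum_pd[OF Ck_on_differentiable[OF P1 assms(2)]] by simp
  then show ?thesis by (simp add: sum_distrib_left mult.assoc)
qed

lemma Ck_on_has_real_derivative:
  fixes \<psi> :: "real \<Rightarrow> real"
  assumes "Ck_on (Suc k) \<psi> T" "r \<in> T"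
  shows "(\<psi> has_real_derivative dd 1 \<psi> r) (at r)"
  using has_real_derivative_along_line[of \<psi> 0 r 1] assms by simp

section \<open>Linear algebra\<close>

lemma matrix_inv_cancel:
  assumes "invertible A"
  shows "A ** matrix_inv A = mat 1 \<and> matrix_inv A ** A = mat 1"
  using assms unfolding invertible_def matrix_inv_def by (rule someI_ex)

text \<open>
  Two linear conditions leave a nonzero solution in dimension three or more.  For the direction
  \<open>Y\<close> of the main argument the conditions are \<open>b(Y) = 0\<close> and \<open>D\<^sub>Y L\<^sup>2 = 0\<close>.
\<close>

lemma exists_nonzero_orthogonal_to_two:
  fixes a b :: "real ^ 'n::finite"
  assumes "CARD('n) > 2"
  obtains v where "v \<noteq> 0" "a \<bullet> v = 0" "b \<bullet> v = 0"
proof -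
  have "dim {a, b} \<le> card {a, b}" by (rule dim_le_card') simp
  also have "\<dots> \<le> 2" by (simp add: card_insert_if)
  finally have "dim {a, b} < DIM(real ^ 'n)" using assms by simp
  then obtain v where "v \<noteq> 0" "\<And>y. y \<in> span {a, b} \<Longrightarrow> orthogonal v y"
    using orthogonal_to_subspace_exists by blast
  then show thesis
    by (intro that[of v]) (auto simp: orthogonal_def inner_commute span_base)
qed

section \<open>Two lemmas on the real line and on connectedness\<close>

text \<open>
  Differentiating \<open>\<psi>1 r = r * \<psi>2 r\<close> gives \<open>r * \<psi>3 r = 0\<close>, so \<open>\<psi>2\<close> has zero derivative except
  possibly at \<open>0\<close>.  Because \<open>\<psi>2\<close> is continuous there, it is the same constant on both sides of
  \<open>0\<close>.  A function \<open>\<psi>\<close> that is only once continuously differentiable could consist of two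
  different parabolas glued at \<open>0\<close>.
\<close>

lemma ode_quadratic:
  fixes \<psi> \<psi>1 \<psi>2 \<psi>3 :: "real \<Rightarrow> real"
  assumes J: "open J" "connected J"
    and \<psi>: "\<And>r. r \<in> J \<Longrightarrow> (\<psi> has_real_derivative \<psi>1 r) (at r)"
           "\<And>r. r \<in> J \<Longrightarrow> (\<psi>1 has_real_derivative \<psi>2 r) (at r)"
           "\<And>r. r \<in> J \<Longrightarrow> (\<psi>2 has_real_derivative \<psi>3 r) (at r)"
    and ode: "\<And>r. r \<in> J \<Longrightarrow> \<psi>1 r = r * \<psi>2 r"
  obtains k k' where "\<And>r. r \<in> J \<Longrightarrow> \<psi> r = k' + k * r\<^sup>2"
proof -
  have "\<psi>3 r = 0" if "r \<in> J - {0}" for r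
  proof -
    have "(\<psi>1 has_real_derivative \<psi>2 r + r * \<psi>3 r) (at r)"
    proof (rule has_field_derivative_transform_within_open[of "\<lambda>r. r * \<psi>2 r" _ _ J])
      show "((\<lambda>r. r * \<psi>2 r) has_real_derivative \<psi>2 r + r * \<psi>3 r) (at r)"
        using that by (auto intro!: derivative_eq_intros \<psi>)
    qed (use that J ode in auto)
    then show ?thesis using DERIV_unique[OF \<psi>(2)] that by force
  qed
  then have "\<forall>r\<in>J - {0}. (\<psi>2 has_real_derivative 0) (at r)"
    using \<psi>(3) by (metis DiffD1)
  moreover have "continuous_on J \<psi>2"
    using \<psi>(3) by (meson DERIV_continuous_on has_field_derivative_at_within)
  ultimately obtain a where a: "\<And>r. r \<in> J \<Longrightarrow> \<psi>2 r = a"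
    using DERIV_zero_connected_constant[OF J(2,1), of "{0}" \<psi>2] by blast
  have zero: "((\<lambda>r. \<psi> r - a / 2 * r\<^sup>2) has_real_derivative 0) (at r)" if "r \<in> J" for r
    using that ode[OF that] a[OF that] by (auto intro!: derivative_eq_intros \<psi>)
  then have "continuous_on J (\<lambda>r. \<psi> r - a / 2 * r\<^sup>2)"
    by (meson DERIV_continuous_on has_field_derivative_at_within)
  with zero obtain k' where "\<And>r. r \<in> J \<Longrightarrow> \<psi> r - a / 2 * r\<^sup>2 = k'"
    using DERIV_zero_connected_constant[OF J(2,1), of "{}" "\<lambda>r. \<psi> r - a / 2 * r\<^sup>2"] by blast
  then show thesis by (intro that[of k' "a / 2"]) (auto simp: algebra_simps)
qed

text \<open>
  A separation of the union would put every \<open>K p\<close> entirely on one side, and by lower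
  semicontinuity the points of either kind form an open set; so it would separate \<open>X\<close>.
\<close>

lemma connected_Union_lower_semicontinuous:
  assumes X: "connected_space X"
    and K: "\<And>p. p \<in> topspace X \<Longrightarrow> connected (K p)" "\<And>p. p \<in> topspace X \<Longrightarrow> K p \<noteq> {}"
    and lsc: "\<And>p r U. p \<in> topspace X \<Longrightarrow> r \<in> K p \<Longrightarrow> open U \<Longrightarrow> r \<in> U \<Longrightarrow>
        \<exists>N. openin X N \<and> p \<in> N \<and> (\<forall>q\<in>N. K q \<inter> U \<noteq> {})"
  shows "connected (\<Union>p\<in>topspace X. K p)"
proof (rule connectedI)
  fix U V
  assume UV: "open U" "open V" "U \<inter> (\<Union>p\<in>topspace X. K p) \<noteq> {}" "V \<inter> (\<Union>p\<in>topspace X. K p) \<noteq> {}"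
    "U \<inter> V \<inter> (\<Union>p\<in>topspace X. K p) = {}" "(\<Union>p\<in>topspace X. K p) \<subseteq> U \<union> V"
  \<comment> \<open>Every \<open>K p\<close> is connected, so the sets \<open>M U\<close> and \<open>M V\<close> will be disjoint.\<close>
  define M where "M Z = {p \<in> topspace X. K p \<inter> Z \<noteq> {}}" for Z
  have openM: "openin X (M Z)" if "open Z" for Z
  proof (subst openin_subopen, intro ballI)
    fix p assume "p \<in> M Z"
    then obtain r where r: "p \<in> topspace X" "r \<in> K p" "r \<in> Z" unfolding M_def by auto
    obtain N where "openin X N" "p \<in> N" "\<forall>q\<in>N. K q \<inter> Z \<noteq> {}"
      using lsc[OF r(1,2) \<open>open Z\<close> r(3)] by metis
    then show "\<exists>T. openin X T \<and> p \<in> T \<and> T \<subseteq> M Z"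
      using openin_subset unfolding M_def by blast
  qed
  have "M U \<inter> M V = {}"
  proof (rule ccontr)
    assume "M U \<inter> M V \<noteq> {}"
    then obtain p where p: "p \<in> topspace X" "K p \<inter> U \<noteq> {}" "K p \<inter> V \<noteq> {}" unfolding M_def by auto
    moreover have "K p \<subseteq> U \<union> V" "U \<inter> V \<inter> K p = {}" using UV(5,6) p(1) by blast+
    ultimately show False using connectedD[OF K(1)[OF p(1)] UV(1,2)] by blast
  qed
  moreover have "topspace X \<subseteq> M U \<union> M V" using K(2) UV(6) unfolding M_def by blast
  moreover have "M U \<noteq> {}" "M V \<noteq> {}" using UV(3,4) unfolding M_def by blast+
  ultimately show False using X openM[OF UV(1)] openM[OF UV(2)] unfolding connected_space_def by blast
qed

section \<open>Metric and Cartan tensor on a fibre\<close>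

lemma metric_tensor_bilinear:
  assumes "open S" "y \<in> S" "Ck_on 2 (\<lambda>z. (L x z)\<^sup>2) S"
  shows "v \<bullet> (metric_tensor L x y *v w) = 1/2 * dd v (dd w (\<lambda>z. (L x z)\<^sup>2)) y"
  unfolding dd_dd_eq_sum_pd[OF assms]
  by (simp add: inner_vec_def matrix_vector_mult_def metric_tensor_def sum_distrib_left mult_ac)

text \<open>
  The order of the three derivatives is that of the definition of the Cartan tensor, with the
  free index \<open>k\<close> outermost, so only finite sums are moved across derivatives.
\<close>

lemma cartan_tensor_contract:
  assumes "open S" "y \<in> S" "Ck_on 3 (\<lambda>z. (L x z)\<^sup>2) S"
  shows "(\<Sum>j\<in>UNIV. w $ j * (\<Sum>i\<in>UNIV. v $ i * cartan_tensor L x y i j k))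
      = 1/4 * pd k (dd v (dd w (\<lambda>z. (L x z)\<^sup>2))) y"
proof -
  let ?P = "\<lambda>z. (L x z)\<^sup>2"
  have P3: "Ck_on (Suc (Suc (Suc 0))) ?P S" using assms(3) by (simp add: numeral_3_eq_3)
  have P2: "Ck_on 2 ?P S" using Ck_on_SucD[OF P3] by (simp add: numeral_2_eq_2)
  have diff: "pd i (pd j ?P) differentiable (at y)" for i j
    unfolding pd_eq_dd using P3 assms(2) by simp
  have cart: "cartan_tensor L x y i j k = 1/4 * pd k (pd i (pd j ?P)) y" for i j
  proof -
    have "pd k (\<lambda>z. 1/2 * pd i (pd j ?P) z) y = 1/2 * pd k (pd i (pd j ?P)) y"
      using dd_sum_const[where I = "{()}" and F = "\<lambda>_. pd i (pd j ?P)" and z = y and v = "axis k 1" and a = "\<lambda>_. 1/2"] diff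
      by (simp add: pd_eq_dd)
    then show ?thesis by (simp add: cartan_tensor_def metric_tensor_def)
  qed
  have "pd k (dd v (dd w ?P)) y
      = pd k (\<lambda>z. \<Sum>(i, j)\<in>UNIV. (v $ i * w $ j) * pd i (pd j ?P) z) y"
    unfolding pd_eq_dd[of k]
    by (rule dd_cong[OF assms(1,2)])
       (simp add: dd_dd_eq_sum_pd[OF assms(1) _ P2] sum.cartesian_product)
  also have "\<dots> = (\<Sum>(i, j)\<in>UNIV. (v $ i * w $ j) * pd k (pd i (pd j ?P)) y)"
    using dd_sum_const[where I = UNIV and F = "\<lambda>(i, j). pd i (pd j ?P)" and z = y and v = "axis k 1"
        and a = "\<lambda>(i, j). v $ i * w $ j"] diff
    by (simp add: pd_eq_dd case_prod_unfold)
  also have "\<dots> = (\<Sum>i\<in>UNIV. \<Sum>j\<in>UNIV. (v $ i * w $ j) * pd k (pd i (pd j ?P)) y)"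
    by (simp add: sum.cartesian_product)
  also have "\<dots> = (\<Sum>j\<in>UNIV. \<Sum>i\<in>UNIV. (v $ i * w $ j) * pd k (pd i (pd j ?P)) y)"
    by (rule sum.swap)
  finally show ?thesis by (simp add: cart sum_distrib_left mult_ac)
qed

text \<open>
  The square of a linear form adds a constant to the metric tensor and nothing to the Cartan
  tensor.  The first part with \<open>a = 0\<close> shows that the square of a linear form alone gives a
  metric tensor of rank at most one.
\<close>

lemma metric_and_cartan_of_quadratic_sum:
  assumes S: "open S" "y \<in> S" and L3: "Ck_on 3 (\<lambda>z. (L x z)\<^sup>2) S"
    and eq: "\<And>z. z \<in> S \<Longrightarrow> (L' x z)\<^sup>2 = a * (L x z)\<^sup>2 + q * (b \<bullet> z)\<^sup>2"
  shows "metric_tensor L' x y $ i $ j = a * metric_tensor L x y $ i $ j + q * (b $ i * b $ j)"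
    and "cartan_tensor L' x y i j k = a * cartan_tensor L x y i j k"
proof -
  let ?E = "\<lambda>z. (L x z)\<^sup>2"
  have E3: "Ck_on (Suc (Suc (Suc 0))) ?E S" using L3 by (simp add: numeral_3_eq_3)
  have first: "pd j (\<lambda>z. (L' x z)\<^sup>2) z = a * pd j ?E z + 2 * q * b $ j * (b \<bullet> z)"
    if "z \<in> S" for z j
  proof -
    define e where "e = ?E"
    have e: "(e has_derivative (\<lambda>v. dd v e z)) (at z)"
      unfolding e_def by (rule Ck_on_has_derivative[OF E3 that])
    have "pd j (\<lambda>z. (L' x z)\<^sup>2) z = pd j (\<lambda>z. a * e z + q * (b \<bullet> z)\<^sup>2) z"
      unfolding pd_eq_dd by (rule dd_cong[OF S(1) that]) (simp add: eq e_def)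
    also have "\<dots> = a * pd j e z + 2 * q * b $ j * (b \<bullet> z)"
      unfolding pd_eq_dd
      by (rule dd_eqI[of _ "\<lambda>v. a * dd v e z + 2 * q * (b \<bullet> v) * (b \<bullet> z)", THEN trans])
         (auto intro!: derivative_eq_intros e simp: inner_axis)
    finally show ?thesis by (simp add: e_def)
  qed
  have second: "metric_tensor L' x z $ i $ j = a * metric_tensor L x z $ i $ j + q * (b $ i * b $ j)"
    if "z \<in> S" for z i j
  proof -
    have E2: "Ck_on (Suc (Suc 0)) (pd j ?E) S" using E3 by (simp add: pd_eq_dd)
    have "pd i (pd j (\<lambda>z. (L' x z)\<^sup>2)) z = pd i (\<lambda>z. a * pd j ?E z + 2 * q * b $ j * (b \<bullet> z)) z"
      unfolding pd_eq_dd[of i] by (rule dd_cong[OF S(1) that first])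
    also have "\<dots> = a * pd i (pd j ?E) z + 2 * q * b $ j * b $ i"
      unfolding pd_eq_dd[of i]
      by (rule dd_eqI[of _ "\<lambda>v. a * dd v (pd j ?E) z + 2 * q * b $ j * (b \<bullet> v)", THEN trans])
         (auto intro!: derivative_eq_intros Ck_on_has_derivative[OF E2 that] simp: inner_axis)
    finally show ?thesis by (simp add: metric_tensor_def)
  qed
  show "metric_tensor L' x y $ i $ j = a * metric_tensor L x y $ i $ j + q * (b $ i * b $ j)"
    using second[OF S(2)] .
  have diff: "(\<lambda>z. metric_tensor L x z $ i $ j) differentiable (at y)"
    unfolding metric_tensor_def pd_eq_dd using E3 S(2) by simp
  have "pd k (\<lambda>z. metric_tensor L' x z $ i $ j) y
      = pd k (\<lambda>z. a * metric_tensor L x z $ i $ j + q * (b $ i * b $ j)) y"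
    unfolding pd_eq_dd by (rule dd_cong[OF S second])
  also have "\<dots> = a * pd k (\<lambda>z. metric_tensor L x z $ i $ j) y"
    unfolding pd_eq_dd
    by (rule dd_eqI[of _ "\<lambda>v. a * dd v (\<lambda>z. metric_tensor L x z $ i $ j) y"])
       (auto intro!: derivative_eq_intros diff[unfolded frechet_derivative_works])
  finally show "cartan_tensor L' x y i j k = a * cartan_tensor L x y i j k"
    by (simp add: cartan_tensor_def)
qed

text \<open>
  On a fibre, with \<open>F\<close> the Finsler function, \<open>b\<close> the covector and \<open>c = e\<^sup>\<sigma>\<close>, this is \<open>\<beta> / (e\<^sup>\<sigma> L)\<close>:
  the slope of the ray through the two arguments of \<open>f\<close>.
\<close>

definition beta_slope :: "(real ^ 'n::finite \<Rightarrow> real) \<Rightarrow> real ^ 'n \<Rightarrow> real \<Rightarrow> real ^ 'n \<Rightarrow> real" where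
  "beta_slope F b c z = (b \<bullet> z) / (c * F z)"

text \<open>
  A Finsler function restricted to the cone of admissible directions at one point.  Three
  derivatives are as many as the Cartan tensor involves.
\<close>

locale finsler_fibre =
  fixes L :: "real ^ 'n \<Rightarrow> real ^ 'n \<Rightarrow> real" and x :: "real ^ 'n::finite" and S :: "(real ^ 'n) set"
  assumes open_S: "open S"
    and cone: "y \<in> S \<Longrightarrow> t > 0 \<Longrightarrow> t *\<^sub>R y \<in> S"
    and smooth: "Ck_on 3 (L x) S"
    and pos: "y \<in> S \<Longrightarrow> L x y > 0"
    and homog: "y \<in> S \<Longrightarrow> t > 0 \<Longrightarrow> L x (t *\<^sub>R y) = t * L x y"
    and nondeg: "y \<in> S \<Longrightarrow> invertible (metric_tensor L x y)"
begin

abbreviation E where "E \<equiv> \<lambda>z. (L x z)\<^sup>2"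
abbreviation g where "g \<equiv> metric_tensor L x"
abbreviation slope where "slope \<equiv> beta_slope (L x)"

lemma L_diff: "z \<in> S \<Longrightarrow> (L x has_derivative (\<lambda>v. dd v (L x) z)) (at z)"
  using smooth Ck_on_has_derivative[of 2 "L x" S z] by (simp add: numeral_3_eq_3 numeral_2_eq_2)

lemma E_smooth: "Ck_on 3 E S"
  using Ck_on_mult[OF open_S smooth smooth] by (simp add: power2_eq_square)

lemma E_smooth2: "Ck_on 2 E S"
  by (rule Ck_on_SucD) (use E_smooth in \<open>simp add: numeral_3_eq_3 numeral_2_eq_2\<close>)

lemma E_diff: "z \<in> S \<Longrightarrow> (E has_derivative (\<lambda>v. dd v E z)) (at z)"
  using E_smooth2 Ck_on_has_derivative[of "Suc 0" E S z] by (simp add: numeral_2_eq_2)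

lemma dd_E_diff: "z \<in> S \<Longrightarrow> (dd w E has_derivative (\<lambda>v. dd v (dd w E) z)) (at z)"
  using E_smooth2 Ck_on_has_derivative[of 0 "dd w E" S z] by (simp add: numeral_2_eq_2)

lemma dd_E: "z \<in> S \<Longrightarrow> dd v E z = 2 * L x z * dd v (L x) z"
  by (rule dd_eqI[of _ "\<lambda>v. 2 * L x z * dd v (L x) z"])
     (auto intro!: derivative_eq_intros L_diff)

lemma metric_bilinear: "y \<in> S \<Longrightarrow> v \<bullet> (g y *v w) = 1/2 * dd v (dd w E) y"
  by (rule metric_tensor_bilinear[where L = L and x = x, OF open_S _ E_smooth2])

lemma metric_symmetric: "y \<in> S \<Longrightarrow> v \<bullet> (g y *v w) = w \<bullet> (g y *v v)"
  using metric_bilinear second_derivative_commute[where F = E, OF open_S _ E_smooth2] by metis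

lemma euler:
  assumes "z \<in> S"
  shows "dd z E z = 2 * E z"
proof -
  have "((\<lambda>t. E (0 + t *\<^sub>R z)) has_real_derivative dd z E (0 + 1 *\<^sub>R z)) (at 1)"
    by (rule has_real_derivative_along_line) (use E_diff[OF assms] in \<open>auto simp: differentiable_def\<close>)
  moreover have "((\<lambda>t. E (0 + t *\<^sub>R z)) has_real_derivative 2 * E z) (at 1)"
  proof (rule has_field_derivative_transform_within_open[of "\<lambda>t. t\<^sup>2 * E z" _ _ "{0<..}"])
    show "((\<lambda>t. t\<^sup>2 * E z) has_real_derivative 2 * E z) (at 1)"
      by (auto intro!: derivative_eq_intros)
  qed (auto simp: homog[OF assms] power_mult_distrib)
  ultimately show ?thesis using DERIV_unique by fastforce
qed

text \<open>
  Differentiating Euler's relation along \<open>v\<close> produces \<open>D\<^sub>v L\<^sup>2\<close> itself plus the second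
  derivative along \<open>v\<close> and \<open>y\<close>, and together they make \<open>2 D\<^sub>v L\<^sup>2\<close>.
\<close>

lemma metric_apply_self:
  assumes y: "y \<in> S"
  shows "v \<bullet> (g y *v y) = 1/2 * dd v E y"
proof -
  have "dd v (\<lambda>z. dd z E z) y = dd v (\<lambda>z. 2 * E z) y"
    by (rule dd_cong[OF open_S y euler])
  also have "\<dots> = 2 * dd v E y"
    by (rule dd_eqI[of _ "\<lambda>v. 2 * dd v E y"]) (auto intro!: has_derivative_mult_right E_diff y)
  finally have *: "dd v (\<lambda>z. dd z E z) y = 2 * dd v E y" .
  have expand: "dd w E z = (\<Sum>j\<in>UNIV. w $ j * pd j E z)" if "z \<in> S" for w z
    by (rule dd_eq_sum_pd) (use E_diff[OF that] in \<open>auto simp: differentiable_def\<close>)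
  have "dd v (\<lambda>z. dd z E z) y = dd v (\<lambda>z. \<Sum>j\<in>UNIV. z $ j * pd j E z) y"
    by (rule dd_cong[OF open_S y expand])
  also have "\<dots> = (\<Sum>j\<in>UNIV. y $ j * dd v (pd j E) y + v $ j * pd j E y)"
    by (rule dd_eqI[of _ "\<lambda>v. \<Sum>j\<in>UNIV. y $ j * dd v (pd j E) y + v $ j * pd j E y"])
       (auto intro!: has_derivative_sum has_derivative_mult dd_E_diff[OF y]
             bounded_linear_imp_has_derivative bounded_linear_vec_nth simp: pd_eq_dd)
  also have "\<dots> = (\<Sum>j\<in>UNIV. y $ j * dd v (pd j E) y) + dd v E y"
    by (simp add: sum.distrib expand[OF y])
  also have "(\<Sum>j\<in>UNIV. y $ j * dd v (pd j E) y) = dd v (dd y E) y"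
  proof -
    have "dd v (dd y E) y = dd v (\<lambda>z. \<Sum>j\<in>UNIV. y $ j * pd j E z) y"
      by (rule dd_cong[OF open_S y expand])
    also have "\<dots> = (\<Sum>j\<in>UNIV. y $ j * dd v (pd j E) y)"
      by (rule dd_sum_const) (use dd_E_diff[OF y] in \<open>auto simp: differentiable_def pd_eq_dd\<close>)
    finally show ?thesis by simp
  qed
  finally have "dd v (dd y E) y = dd v E y" using * by simp
  then show ?thesis using metric_bilinear[OF y] by simp
qed

lemma metric_b_up:
  assumes "y \<in> S"
  shows "g y *v b_up L b x y = b"
proof -
  have "b_up L b x y = matrix_inv (g y) *v b"
    by (simp add: b_up_def matrix_vector_mult_def inverse_metric_def)
  moreover have "g y ** matrix_inv (g y) = mat 1"
    using matrix_inv_cancel[OF nondeg[OF assms]] by simp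
  ultimately show ?thesis by (simp add: matrix_vector_mul_assoc)
qed

lemma y_low_eq: "y_low L x y = g y *v y"
  by (simp add: y_low_def matrix_vector_mult_def)

text \<open>
  Expand \<open>m = b - (\<beta> / L\<^sup>2) g y\<close> using \<open>g\<^sup>-\<^sup>1 b = B\<close>, \<open>g\<^sup>-\<^sup>1 (g y) = y\<close> and \<open>g(y, y) = L\<^sup>2\<close>.
\<close>

lemma m_sq_eq:
  assumes y: "y \<in> S"
  shows "m_sq L b x y = b \<bullet> b_up L b x y - (b \<bullet> y)\<^sup>2 / E y"
proof -
  define a where "a = (b \<bullet> y) / E y"
  let ?B = "b_up L b x y" let ?m = "m_low L b x y"
  have m: "?m = b - a *\<^sub>R (g y *v y)"
    by (simp add: m_low_def y_low_eq vec_eq_iff a_def)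
  have inv: "matrix_inv (g y) ** g y = mat 1"
    using matrix_inv_cancel[OF nondeg[OF y]] by simp
  have "matrix_inv (g y) *v ?m = matrix_inv (g y) *v b - a *\<^sub>R y"
    by (simp add: m matrix_vector_mult_diff_distrib matrix_vector_mult_scaleR
        matrix_vector_mul_assoc inv)
  also have "matrix_inv (g y) *v b = ?B"
    by (simp add: b_up_def matrix_vector_mult_def inverse_metric_def)
  finally have *: "matrix_inv (g y) *v ?m = ?B - a *\<^sub>R y" .
  have "m_sq L b x y = ?m \<bullet> (matrix_inv (g y) *v ?m)"
    by (simp add: m_sq_def inverse_metric_def inner_vec_def matrix_vector_mult_def
        sum_distrib_left mult_ac)
  also have "\<dots> = b \<bullet> ?B - a * (b \<bullet> y) - a * (?B \<bullet> (g y *v y)) + a * a * (y \<bullet> (g y *v y))"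
    unfolding * by (simp add: m inner_diff_left inner_diff_right algebra_simps inner_commute)
  also have "?B \<bullet> (g y *v y) = b \<bullet> y"
    using metric_symmetric[OF y, of ?B y] metric_b_up[OF y, of b] by (simp add: inner_commute)
  also have "y \<bullet> (g y *v y) = E y"
    using metric_apply_self[OF y, of y] euler[OF y] by simp
  also have "a * a * E y = a * (b \<bullet> y)"
  proof -
    have "a * E y = b \<bullet> y" using pos[OF y] by (simp add: a_def)
    then show ?thesis by (simp add: mult.assoc)
  qed
  finally show ?thesis by (simp add: a_def power2_eq_square)
qed

definition dslope :: "real ^ 'n \<Rightarrow> real \<Rightarrow> real ^ 'n \<Rightarrow> real ^ 'n \<Rightarrow> real" where
  "dslope b c z v = (b \<bullet> v) / (c * L x z) - (b \<bullet> z) * dd v (L x) z / (c * (L x z)\<^sup>2)"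

lemma slope_has_derivative:
  assumes "z \<in> S" "c > 0"
  shows "(slope b c has_derivative dslope b c z) (at z)"
proof -
  have "c * L x z \<noteq> 0" "L x z \<noteq> 0" using assms pos[OF assms(1)] by auto
  then have "((\<lambda>z. (b \<bullet> z) / (c * L x z)) has_derivative dslope b c z) (at z)"
    by (auto intro!: derivative_eq_intros L_diff assms(1)
        simp: dslope_def[abs_def] fun_eq_iff field_simps power2_eq_square)
  then show ?thesis by (simp add: beta_slope_def[abs_def])
qed

text \<open>
  The direction \<open>b\<^sup>i\<close> changes the slope at a rate proportional to \<open>m\<^sup>2\<close>.  This is how the
  assumption \<open>m\<^sup>2 \<noteq> 0\<close> enters: it makes the slope an open map, and it permits cancelling the
  derivative of the slope from the contracted Cartan tensor.
\<close>

lemma dslope_b_up: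
  assumes "y \<in> S" "c > 0"
  shows "dslope b c y (b_up L b x y) = m_sq L b x y / (c * L x y)"
proof -
  let ?B = "b_up L b x y"
  have "L x y * dd ?B (L x) y = ?B \<bullet> (g y *v y)"
    using metric_apply_self[OF assms(1), of ?B] dd_E[OF assms(1), of ?B] by simp
  also have "\<dots> = b \<bullet> y"
    using metric_symmetric[OF assms(1), of ?B y] metric_b_up[OF assms(1), of b] by (simp add: inner_commute)
  finally have "dd ?B (L x) y = (b \<bullet> y) / L x y"
    using pos[OF assms(1)] by (simp add: field_simps)
  then show ?thesis
    using pos[OF assms(1)] assms(2) unfolding m_sq_eq[OF assms(1)] dslope_def
    by (simp add: field_simps power2_eq_square)
qed

lemma continuous_on_slope: "c > 0 \<Longrightarrow> continuous_on S (slope b c)"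
  using slope_has_derivative
  by (metis continuous_at_imp_continuous_on has_derivative_continuous)

lemma open_slope_image:
  assumes "c > 0" and msq: "\<And>y. y \<in> S \<Longrightarrow> m_sq L b x y \<noteq> 0"
  shows "open (slope b c ` S)"
proof -
  have "slope b c y \<in> interior (slope b c ` S)" if y: "y \<in> S" for y
  proof (rule sussmann_open_mapping[OF open_S continuous_on_slope[OF assms(1)] y
        slope_has_derivative[OF y assms(1)]])
    let ?B = "b_up L b x y" let ?l = "dslope b c y ?B"
    have l: "?l \<noteq> 0" using msq[OF y] assms(1) pos[OF y] by (simp add: dslope_b_up[OF y])
    \<comment> \<open>A right inverse of the differential, with values in the line spanned by \<open>b\<^sup>i\<close>.\<close>
    show "bounded_linear (\<lambda>r. (r / ?l) *\<^sub>R ?B)"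
      unfolding linear_conv_bounded_linear[symmetric]
      by (auto intro!: linearI simp: add_divide_distrib scaleR_left_distrib)
    have "dslope b c y (t *\<^sub>R ?B) = t * ?l" for t
      using has_derivative_linear[OF slope_has_derivative[OF y assms(1)]]
      by (simp add: linear_cmul)
    then show "dslope b c y \<circ> (\<lambda>r. (r / ?l) *\<^sub>R ?B) = id"
      using l by (auto simp: fun_eq_iff)
    show "S \<subseteq> S" "y \<in> interior S" using y open_S by (auto simp: interior_open)
  qed
  then show ?thesis
    by (metis image_subsetI interior_subset interior_eq subset_antisym)
qed

section \<open>The differential equation for the profile\<close>

text \<open>
  The heart of the proof.  The mixed third derivative along \<open>Y\<close>, \<open>B\<close> and \<open>e\<^sub>k\<close> is
  taken in this order.  After the first step every term carries the factor \<open>w = D\<^sub>Y L\<^sup>2\<close>, and of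
  the Leibniz expansion of the other two steps only the term with one derivative on each factor,
  \<open>D\<^sub>B h * D\<^sub>k w\<close>, survives at \<open>y\<close>.
\<close>

lemma changed_b_condition_forces_ode:
  fixes L' :: "real ^ 'n \<Rightarrow> real ^ 'n \<Rightarrow> real"
  assumes dim: "CARD('n) > 2" and y: "y \<in> S" and c: "c > 0"
    and \<psi>: "\<And>r. r \<in> T \<Longrightarrow> (\<psi> has_real_derivative \<psi>1 r) (at r)"
           "\<And>r. r \<in> T \<Longrightarrow> (\<psi>1 has_real_derivative \<psi>2 r) (at r)"
           "\<And>r. r \<in> T \<Longrightarrow> (\<psi>2 has_real_derivative \<psi>3 r) (at r)"
    and T: "\<And>z. z \<in> S \<Longrightarrow> slope b c z \<in> T"
    and L': "\<And>z. z \<in> S \<Longrightarrow> (L' x z)\<^sup>2 = (c * L x z)\<^sup>2 * \<psi> (slope b c z)"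
    and smooth': "Ck_on 3 (\<lambda>z. (L' x z)\<^sup>2) S"
    and msq: "m_sq L b x y \<noteq> 0"
    and bL: "\<And>j k. (\<Sum>i\<in>UNIV. b_up L b x y $ i * cartan_tensor L x y i j k) = 0"
    and bL': "\<And>j k. (\<Sum>i\<in>UNIV. b_up L b x y $ i * cartan_tensor L' x y i j k) = 0"
  shows "\<psi>1 (slope b c y) = slope b c y * \<psi>2 (slope b c y)"
proof -
  let ?B = "b_up L b x y" and ?\<rho> = "slope b c" and ?P = "\<lambda>z. (L' x z)\<^sup>2"
  obtain Y where Y: "Y \<noteq> 0" "b \<bullet> Y = 0" "(g y *v y) \<bullet> Y = 0"
    using exists_nonzero_orthogonal_to_two[OF dim] .
  define w where "w = dd Y E"
  \<comment> \<open>At \<open>y\<close>, \<open>w\<close> vanishes by the choice of \<open>Y\<close>, its derivative along \<open>B\<close> is \<open>2 b(Y)\<close>, and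
    its second derivatives along \<open>B\<close> are those in the b-condition for \<open>L\<close>.\<close>
  have w0: "w y = 0"
    using metric_apply_self[OF y, of Y] Y(3) by (simp add: w_def inner_commute)
  have w1: "dd ?B w y = 0"
    using metric_bilinear[OF y, of ?B Y] metric_symmetric[OF y, of ?B Y] metric_b_up[OF y, of b] Y(2)
    by (simp add: w_def inner_commute)
  have w2: "pd k (dd ?B w) y = 0" for k
    using cartan_tensor_contract[where L = L and x = x and w = Y and v = "?B" and k = k,
        OF open_S y E_smooth] bL
    by (simp add: w_def)
  have P2: "pd k (dd ?B (dd Y ?P)) y = 0" for k
    using cartan_tensor_contract[where L = L' and x = x and w = Y and v = "?B" and k = k,
        OF open_S y smooth'] bL'
    by simp
  \<comment> \<open>Some coordinate derivative of \<open>w\<close> does not vanish, since \<open>g\<close> is nondegenerate.\<close>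
  have "g y *v Y \<noteq> 0"
    using Y(1) nondeg[OF y] by (metis matrix_inv_cancel matrix_vector_mul_assoc matrix_vector_mul_lid
        matrix_vector_mult_0_right)
  then obtain k where "(g y *v Y) $ k \<noteq> 0" by (auto simp: vec_eq_iff)
  then have k: "pd k w y \<noteq> 0"
    using metric_bilinear[OF y, of "axis k 1" Y] by (simp add: w_def pd_eq_dd inner_axis')
  \<comment> \<open>\<open>h = c\<^sup>2 \<chi>(slope)\<close> and \<open>a z\<close> is its differential, in which \<open>\<chi>' = (\<psi>' - r \<psi>'') / 2\<close>.\<close>
  define h where "h z = c\<^sup>2 * (\<psi> (?\<rho> z) - ?\<rho> z * \<psi>1 (?\<rho> z) / 2)" for z
  define a where "a z v = c\<^sup>2 * ((\<psi>1 (?\<rho> z) - ?\<rho> z * \<psi>2 (?\<rho> z)) / 2) * dslope b c z v" for z v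
  have comp: "((\<lambda>z. \<phi> (?\<rho> z)) has_derivative (\<lambda>v. \<phi>' * dslope b c z v)) (at z)"
    if "(\<phi> has_real_derivative \<phi>') (at (?\<rho> z))" "z \<in> S" for \<phi> \<phi>' z
    by (rule has_derivative_compose[OF slope_has_derivative[OF that(2) c]
          that(1)[unfolded has_field_derivative_def]])
  have h: "(h has_derivative a z) (at z)" if z: "z \<in> S" for z
    unfolding h_def[abs_def] a_def[abs_def]
    by (auto intro!: derivative_eq_intros slope_has_derivative c z comp[OF \<psi>(1)[OF T[OF z]]]
        comp[OF \<psi>(2)[OF T[OF z]]] simp: fun_eq_iff field_simps)
  have w': "(w has_derivative (\<lambda>v. dd v w z)) (at z)" if "z \<in> S" for z
    using dd_E_diff[OF that] by (simp add: w_def)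
  have first: "dd Y ?P z = h z * w z" if z: "z \<in> S" for z
  proof -
    have Lz: "L x z \<noteq> 0" using pos[OF z] by simp
    have "dd Y ?P z = dd Y (\<lambda>z. (c * L x z)\<^sup>2 * \<psi> (?\<rho> z)) z"
      by (rule dd_cong[OF open_S z L'])
    also have "\<dots> = (c * L x z)\<^sup>2 * (\<psi>1 (?\<rho> z) * dslope b c z Y)
        + 2 * (c * L x z) * (c * dd Y (L x) z) * \<psi> (?\<rho> z)"
      by (rule dd_eqI[of _ "\<lambda>v. (c * L x z)\<^sup>2 * (\<psi>1 (?\<rho> z) * dslope b c z v)
        + 2 * (c * L x z) * (c * dd v (L x) z) * \<psi> (?\<rho> z)"])
         (auto intro!: derivative_eq_intros L_diff z comp[OF \<psi>(1)[OF T[OF z]]])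
    also have "dslope b c z Y = - ?\<rho> z * dd Y (L x) z / L x z"
      using Lz c by (simp add: dslope_def beta_slope_def Y(2) power2_eq_square)
    finally have P: "dd Y ?P z = (c * L x z)\<^sup>2 * (\<psi>1 (?\<rho> z) * (- ?\<rho> z * dd Y (L x) z / L x z))
        + 2 * (c * L x z) * (c * dd Y (L x) z) * \<psi> (?\<rho> z)" .
    have "w z = 2 * L x z * dd Y (L x) z"
      unfolding w_def by (rule dd_E[OF z])
    then show ?thesis
      unfolding P using Lz by (simp add: h_def field_simps power2_eq_square)
  qed
  have second: "dd ?B (dd Y ?P) z = h z * dd ?B w z + a z ?B * w z" if z: "z \<in> S" for z
  proof -
    have "dd ?B (dd Y ?P) z = dd ?B (\<lambda>z. h z * w z) z"
      by (rule dd_cong[OF open_S z first])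
    also have "\<dots> = h z * dd ?B w z + a z ?B * w z"
      by (rule dd_eqI[OF has_derivative_mult[OF h[OF z] w'[OF z]]])
    finally show ?thesis .
  qed
  have L1: "(dd ?B (L x) has_derivative (\<lambda>v. dd v (dd ?B (L x)) y)) (at y)"
    using smooth y Ck_on_has_derivative[of "Suc 0" "dd ?B (L x)" S y] by (simp add: numeral_3_eq_3)
  have "(\<lambda>z. dslope b c z ?B) differentiable (at y)"
    unfolding dslope_def differentiable_def
    using pos[OF y] c
    by (intro exI) (rule derivative_eq_intros L1 L_diff y refl | simp)+
  then obtain d where d: "((\<lambda>z. dslope b c z ?B) has_derivative d) (at y)"
    unfolding differentiable_def by blast
  have "(\<lambda>z. a z ?B) differentiable (at y)"
    unfolding a_def differentiable_def
    by (intro exI) (rule derivative_eq_intros d slope_has_derivative[OF y c]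
        comp[OF \<psi>(2)[OF T[OF y]] y] comp[OF \<psi>(3)[OF T[OF y]] y] refl | simp)+
  then obtain a' where a': "((\<lambda>z. a z ?B) has_derivative a') (at y)"
    unfolding differentiable_def by blast
  have w'': "(dd ?B w has_derivative (\<lambda>v. dd v (dd ?B w) y)) (at y)"
    using E_smooth y Ck_on_has_derivative[of 0 "dd ?B w" S y] by (simp add: numeral_3_eq_3 w_def)
  have "pd k (dd ?B (dd Y ?P)) y = pd k (\<lambda>z. h z * dd ?B w z + a z ?B * w z) y"
    unfolding pd_eq_dd by (rule dd_cong[OF open_S y second])
  also have "\<dots> = (h y * pd k (dd ?B w) y + a y (axis k 1) * dd ?B w y)
      + (a y ?B * pd k w y + a' (axis k 1) * w y)"
    unfolding pd_eq_dd
    by (rule dd_eqI[OF has_derivative_add[OF has_derivative_mult[OF h[OF y] w'']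
          has_derivative_mult[OF a' w'[OF y]]]])
  finally have "a y ?B * pd k w y = 0"
    using w0 w1 w2 P2 by simp
  then have "a y ?B = 0" using k by simp
  then show ?thesis
    using msq c pos[OF y] unfolding a_def dslope_b_up[OF y c] by simp
qed

end

section \<open>The change on the manifold\<close>

locale beta_change =
  fixes X :: "'a topology"
    and A :: "('a, 'n::finite) chart set"
    and D :: "('a, 'n) chart \<Rightarrow> ((real ^ 'n) \<times> (real ^ 'n)) set"
    and L :: "('a, 'n) chart \<Rightarrow> real ^ 'n \<Rightarrow> real ^ 'n \<Rightarrow> real"
    and f :: "real \<Rightarrow> real \<Rightarrow> real"
    and W :: "(real \<times> real) set"
    and \<sigma> :: "'a \<Rightarrow> real"
    and b :: "('a, 'n) chart \<Rightarrow> real ^ 'n \<Rightarrow> real ^ 'n"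
  assumes manifold: "smooth_manifold X A" "connected_space X"
    and finsler: "conic_domain A D" "finsler_structure A D L"
    and change: "generalized_beta_conformal_change A D L f W \<sigma> b"
    and standing: "standing_assumptions A D L f \<sigma> b"
begin

abbreviation fibre where "fibre c x \<equiv> {y. (x, y) \<in> D c}"
abbreviation factor where "factor c x \<equiv> exp (\<sigma> (chart_inv c x))"
abbreviation ratio where "ratio c x \<equiv> beta_slope (L c x) (b c x) (factor c x)"
abbreviation Lbar where "Lbar \<equiv> L_bar f \<sigma> b L"

lemma finsler_bar: "finsler_structure A D Lbar"
  using change unfolding generalized_beta_conformal_change_def by blast

lemma fibre_finsler:
  assumes "c \<in> A" "finsler_structure A D L'"
  shows "finsler_fibre (L' c) x (fibre c x)"
proof
  have D: "open (D c)" "\<And>x y t. t > 0 \<Longrightarrow> (x, y) \<in> D c \<Longrightarrow> (x, t *\<^sub>R y) \<in> D c"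
    using finsler(1) assms(1) unfolding conic_domain_def by blast+
  show "open (fibre c x)" by (rule open_slice[OF D(1)])
  show "t *\<^sub>R y \<in> fibre c x" if "y \<in> fibre c x" "t > 0" for y t using D(2) that by auto
  have "Ck_on 3 (\<lambda>(x, y). L' c x y) (D c)"
    using assms unfolding finsler_structure_def smooth_on_def by blast
  from Ck_on_slice[OF D(1) this] show "Ck_on 3 (L' c x) (fibre c x)" by simp
  have *: "L' c x y > 0 \<and> (\<forall>t>0. L' c x (t *\<^sub>R y) = t * L' c x y) \<and> invertible (metric_tensor (L' c) x y)"
    if "(x, y) \<in> D c" for y
    using assms that unfolding finsler_structure_def by blast
  show "L' c x y > 0" if "y \<in> fibre c x" for y using * that by blast
  show "L' c x (t *\<^sub>R y) = t * L' c x y" if "y \<in> fibre c x" "t > 0" for y t using * that by blast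
  show "invertible (metric_tensor (L' c) x y)" if "y \<in> fibre c x" for y using * that by blast
qed

lemma L_pos: "c \<in> A \<Longrightarrow> (x, y) \<in> D c \<Longrightarrow> L c x y > 0"
  using finsler_fibre.pos[OF fibre_finsler[OF _ finsler(2)]] by simp

lemma Lbar_pos: "c \<in> A \<Longrightarrow> (x, y) \<in> D c \<Longrightarrow> Lbar c x y > 0"
  using finsler_fibre.pos[OF fibre_finsler[OF _ finsler_bar]] by simp

lemma m_sq_nonzero:
  assumes "c \<in> A" "(x, y) \<in> D c"
  shows "m_sq (L c) (b c x) x y \<noteq> 0"
  using standing assms unfolding standing_assumptions_def Let_def by blast

lemma W_cone: "(u, v) \<in> W \<Longrightarrow> t > 0 \<Longrightarrow> (t * u, t * v) \<in> W \<and> f (t * u) (t * v) = t * f u v"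
  using change unfolding generalized_beta_conformal_change_def by blast

text \<open>
  The domain of \<open>f\<close> is a cone, so the point \<open>(e\<^sup>\<sigma> L, \<beta>)\<close> may be scaled to first coordinate
  \<open>1\<close>; this lets the profile \<open>f(1, -)\<close> represent \<open>f\<close>.
\<close>

lemma ratio_in_W:
  assumes "c \<in> A" "(x, y) \<in> D c"
  shows "(1, ratio c x y) \<in> W"
proof -
  have *: "(factor c x * L c x y, b c x \<bullet> y) \<in> W"
    using change assms unfolding generalized_beta_conformal_change_def L_tilde_def beta_def by blast
  show ?thesis
    using W_cone[OF *, of "1 / (factor c x * L c x y)"] L_pos[OF assms]
    by (simp add: beta_slope_def)
qed

lemma Lbar_eq:
  assumes "c \<in> A" "(x, y) \<in> D c"
  shows "Lbar c x y = factor c x * L c x y * f 1 (ratio c x y)"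
  using W_cone[OF ratio_in_W[OF assms], of "factor c x * L c x y"] L_pos[OF assms]
  by (simp add: L_bar_def L_tilde_def beta_def beta_slope_def)

lemma chart_props:
  assumes "c \<in> A"
  shows "openin X (chart_dom c)" "open (chart_img c)"
    "homeomorphic_map (subtopology X (chart_dom c)) (top_of_set (chart_img c)) (snd c)"
    "chart_dom c \<subseteq> topspace X" "inj_on (snd c) (chart_dom c)"
proof -
  show *: "openin X (chart_dom c)" "open (chart_img c)"
    "homeomorphic_map (subtopology X (chart_dom c)) (top_of_set (chart_img c)) (snd c)"
    using manifold(1) assms unfolding smooth_manifold_def by blast+
  show "chart_dom c \<subseteq> topspace X" using *(1) by (rule openin_subset)
  then show "inj_on (snd c) (chart_dom c)"
    using homeomorphic_imp_injective_map[OF *(3)] by (simp add: Int_absorb1)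
qed

lemma chart_inv_chart: "c \<in> A \<Longrightarrow> p \<in> chart_dom c \<Longrightarrow> chart_inv c (snd c p) = p"
  unfolding chart_inv_def using chart_props(5) by (simp add: inv_into_f_f)

lemma D_subset: "c \<in> A \<Longrightarrow> (x, y) \<in> D c \<Longrightarrow> x \<in> chart_img c"
  using finsler(1) unfolding conic_domain_def by blast

text \<open>
  All charts around the point are allowed at once, so that the definition involves no choice;
  \<open>ratios_eq\<close> shows that any one of them gives the whole set.
\<close>

definition ratios :: "'a \<Rightarrow> real set" where
  "ratios p = (\<Union>c \<in> {c \<in> A. p \<in> chart_dom c}. ratio c (snd c p) ` fibre c (snd c p))"

definition all_ratios :: "real set" where
  "all_ratios = {ratio c x y | c x y. c \<in> A \<and> (x, y) \<in> D c}"

lemma ratio_push: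
  assumes "c \<in> A" "d \<in> A" "p \<in> chart_dom c \<inter> chart_dom d" "(snd c p, y) \<in> D c"
  shows "(snd d p, push c d p y) \<in> D d" "ratio d (snd d p) (push c d p y) = ratio c (snd c p) y"
proof -
  show "(snd d p, push c d p y) \<in> D d"
    using finsler(1) assms unfolding conic_domain_def by blast
  have "L d (snd d p) (push c d p y) = L c (snd c p) y"
    using finsler(2) assms unfolding finsler_structure_def by blast
  moreover have "one_form A b"
    using change unfolding generalized_beta_conformal_change_def by blast
  then have "b d (snd d p) \<bullet> push c d p y = b c (snd c p) \<bullet> y"
    using assms unfolding one_form_def by blast
  ultimately show "ratio d (snd d p) (push c d p y) = ratio c (snd c p) y"
    using assms chart_inv_chart by (simp add: beta_slope_def)
qed

lemma ratios_eq:
  assumes "c \<in> A" "p \<in> chart_dom c"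
  shows "ratios p = ratio c (snd c p) ` fibre c (snd c p)"
proof -
  have "ratio d (snd d p) ` fibre d (snd d p) \<subseteq> ratio c (snd c p) ` fibre c (snd c p)"
    if d: "d \<in> A" "p \<in> chart_dom d" for d
  proof
    fix r assume "r \<in> ratio d (snd d p) ` fibre d (snd d p)"
    then obtain y where y: "(snd d p, y) \<in> D d" "r = ratio d (snd d p) y" by auto
    have "p \<in> chart_dom d \<inter> chart_dom c" using d assms by simp
    from ratio_push[OF d(1) assms(1) this y(1)] y(2)
    show "r \<in> ratio c (snd c p) ` fibre c (snd c p)" by force
  qed
  then show ?thesis unfolding ratios_def using assms by blast
qed

lemma all_ratios_eq: "all_ratios = (\<Union>p\<in>topspace X. ratios p)"
proof -
  have cover: "(\<Union>c\<in>A. chart_dom c) = topspace X"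
    using manifold(1) unfolding smooth_manifold_def by blast
  show ?thesis
  proof (intro equalityI subsetI)
    fix r assume "r \<in> all_ratios"
    then obtain c x y where cxy: "c \<in> A" "(x, y) \<in> D c" "r = ratio c x y" unfolding all_ratios_def by auto
    then obtain p where p: "p \<in> chart_dom c" "x = snd c p" using D_subset by blast
    then have "r \<in> ratios p" using cxy ratios_eq[OF cxy(1) p(1)] by blast
    then show "r \<in> (\<Union>p\<in>topspace X. ratios p)" using cover cxy(1) p(1) by blast
  next
    fix r assume "r \<in> (\<Union>p\<in>topspace X. ratios p)"
    then show "r \<in> all_ratios" unfolding all_ratios_def ratios_def by auto
  qed
qed

lemma ratio_continuous_base:
  assumes c: "c \<in> A"
  shows "continuous_on {x. (x, y) \<in> D c} (\<lambda>x. ratio c x y)"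
proof -
  let ?T = "{x. (x, y) \<in> D c}"
  have sub: "?T \<subseteq> chart_img c" using D_subset[OF c] by blast
  have "Ck_on 0 (\<lambda>(x, y). L c x y) (D c)"
    using finsler(2) c unfolding finsler_structure_def smooth_on_def by blast
  then have "continuous_on (D c) (\<lambda>(x, y). L c x y)" by simp
  from continuous_on_compose2[OF this, of ?T "\<lambda>x. (x, y)"]
  have "continuous_on ?T (\<lambda>x. L c x y)"
    by (force intro: continuous_on_Pair continuous_on_id continuous_on_const)
  moreover have "Ck_on 0 (\<sigma> \<circ> chart_inv c) (chart_img c)" "Ck_on 0 (b c) (chart_img c)"
    using change c
    unfolding generalized_beta_conformal_change_def smooth_function_def one_form_def smooth_on_def
    by blast+
  then have "continuous_on ?T (\<lambda>x. \<sigma> (chart_inv c x))" "continuous_on ?T (b c)"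
    using sub by (auto simp: o_def intro: continuous_on_subset)
  ultimately show ?thesis
    unfolding beta_slope_def
    by (intro continuous_intros) (metis L_pos[OF c] exp_not_eq_zero less_irrefl mem_Collect_eq mult_eq_0_iff)+
qed

text \<open>
  Over one point the ratios are the continuous image of a connected cone.  They depend on the
  point in a lower semicontinuous way: a direction that realises a ratio at \<open>p\<close> stays admissible,
  and its ratio stays close, when the base point moves within a chart.
\<close>

lemma connected_all_ratios: "connected all_ratios"
  unfolding all_ratios_eq
proof (rule connected_Union_lower_semicontinuous[OF manifold(2)])
  fix p assume p: "p \<in> topspace X"
  then obtain c where c: "c \<in> A" "p \<in> chart_dom c"
    using manifold(1) unfolding smooth_manifold_def by blast
  have fibre: "connected (fibre c (snd c p))" "fibre c (snd c p) \<noteq> {}"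
    using finsler(1) c unfolding conic_domain_def by blast+
  show "connected (ratios p)"
    unfolding ratios_eq[OF c]
    by (intro connected_continuous_image fibre finsler_fibre.continuous_on_slope[OF fibre_finsler[OF c(1) finsler(2)]]) simp
  show "ratios p \<noteq> {}" using fibre(2) unfolding ratios_eq[OF c] by blast
  fix r U assume r: "r \<in> ratios p" and U: "open U" "r \<in> U"
  then obtain y where y: "(snd c p, y) \<in> D c" "r = ratio c (snd c p) y"
    unfolding ratios_eq[OF c] by auto
  let ?T = "{x. (x, y) \<in> D c}"
  define M where "M = ?T \<inter> (\<lambda>x. ratio c x y) -` U"
  have "?T = (\<lambda>x. (x, y)) -` D c" by auto
  moreover have "open (D c)" using finsler(1) c unfolding conic_domain_def by blast
  ultimately have "open ?T" by (simp add: open_vimage continuous_intros)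
  then have "open M" unfolding M_def by (intro continuous_open_preimage ratio_continuous_base c U)
  moreover have "M \<subseteq> chart_img c" unfolding M_def using D_subset[OF c(1)] by auto
  ultimately have M: "openin (top_of_set (chart_img c)) M" by (simp add: openin_open_eq chart_props[OF c(1)] open_subset)
  define N where "N = {q \<in> chart_dom c. snd c q \<in> M}"
  have "openin (subtopology X (chart_dom c)) {q \<in> topspace (subtopology X (chart_dom c)). snd c q \<in> M}"
    by (rule openin_continuous_map_preimage[OF homeomorphic_imp_continuous_map[OF chart_props(3)[OF c(1)]] M])
  then have "openin X N"
    using chart_props(1,4)[OF c(1)] by (auto simp: N_def Int_absorb1 intro: openin_trans_full)
  moreover have "p \<in> N" using c y U by (simp add: N_def M_def)
  moreover have "ratios q \<inter> U \<noteq> {}" if "q \<in> N" for q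
    using that c(1) ratios_eq[of c q] by (auto simp: N_def M_def)
  ultimately show "\<exists>N. openin X N \<and> p \<in> N \<and> (\<forall>q\<in>N. ratios q \<inter> U \<noteq> {})" by blast
qed

lemma open_all_ratios: "open all_ratios"
proof -
  have "all_ratios = (\<Union>c\<in>A. \<Union>x. ratio c x ` fibre c x)"
    unfolding all_ratios_def by blast
  moreover have "open (ratio c x ` fibre c x)" if "c \<in> A" for c x
    by (rule finsler_fibre.open_slope_image[OF fibre_finsler[OF that finsler(2)]])
       (use m_sq_nonzero[OF that] in auto)
  ultimately show ?thesis by (simp only:) (intro open_UN ballI)
qed

lemma f_pos_all_ratios:
  assumes "r \<in> all_ratios"
  shows "f 1 r > 0"
proof -
  obtain c x y where "c \<in> A" "(x, y) \<in> D c" "r = ratio c x y" using assms unfolding all_ratios_def by auto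
  then show ?thesis using Lbar_pos Lbar_eq L_pos by (metis exp_gt_zero mult_pos_pos zero_less_mult_pos)
qed

lemma b_condition_bar_imp_profile:
  assumes dim: "CARD('n) > 2" and bL: "b_condition A D b L L" and bLbar: "b_condition A D b L Lbar"
  obtains k k' where "\<And>r. r \<in> all_ratios \<Longrightarrow> (f 1 r)\<^sup>2 = k' + k * r\<^sup>2"
proof -
  let ?T = "{r. (1, r) \<in> W}"
  define \<psi> where "\<psi> r = (f 1 r)\<^sup>2" for r
  have W: "open W" "Ck_on 3 (\<lambda>(u, v). f u v) W"
    using change unfolding generalized_beta_conformal_change_def smooth_on_def by blast+
  have "Ck_on 3 (f 1) ?T" using Ck_on_slice[OF W, of 1] by simp
  then have "Ck_on 3 \<psi> ?T"
    using Ck_on_mult[OF open_slice[OF W(1)]] unfolding \<psi>_def power2_eq_square by blast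
  then have \<psi>3: "Ck_on (Suc (Suc (Suc 0))) \<psi> ?T" by (simp add: numeral_3_eq_3)
  define \<psi>1 where "\<psi>1 = dd 1 \<psi>"
  define \<psi>2 where "\<psi>2 = dd 1 \<psi>1"
  define \<psi>3 where "\<psi>3 = dd 1 \<psi>2"
  have Ck: "Ck_on (Suc (Suc 0)) \<psi>1 ?T" "Ck_on (Suc 0) \<psi>2 ?T"
    using \<psi>3 unfolding \<psi>1_def \<psi>2_def by simp_all
  have deriv: "(\<psi> has_real_derivative \<psi>1 r) (at r)" "(\<psi>1 has_real_derivative \<psi>2 r) (at r)"
    "(\<psi>2 has_real_derivative \<psi>3 r) (at r)" if "r \<in> ?T" for r
    unfolding \<psi>3_def
    using Ck_on_has_real_derivative[OF \<psi>3 that] Ck_on_has_real_derivative[OF Ck(1) that]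
      Ck_on_has_real_derivative[OF Ck(2) that] unfolding \<psi>1_def \<psi>2_def by blast+
  have J: "r \<in> ?T" if "r \<in> all_ratios" for r using that ratio_in_W unfolding all_ratios_def by auto
  have "\<psi>1 r = r * \<psi>2 r" if r_in: "r \<in> all_ratios" for r
  proof -
    obtain c x y where c: "c \<in> A" and xy: "(x, y) \<in> D c" and r: "r = ratio c x y"
      using r_in unfolding all_ratios_def by blast
    interpret finsler_fibre "L c" x "fibre c x" by (rule fibre_finsler[OF c finsler(2)])
    interpret bar: finsler_fibre "Lbar c" x "fibre c x" by (rule fibre_finsler[OF c finsler_bar])
    show ?thesis unfolding r
    proof (rule changed_b_condition_forces_ode[where T = ?T, OF dim _ _ deriv])
      show "(Lbar c x z)\<^sup>2 = (factor c x * L c x z)\<^sup>2 * \<psi> (ratio c x z)" if "z \<in> fibre c x" for z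
        using that by (simp add: Lbar_eq[OF c] \<psi>_def power_mult_distrib)
      show "Ck_on 3 (\<lambda>z. (Lbar c x z)\<^sup>2) (fibre c x)" by (rule bar.E_smooth)
      show "m_sq (L c) (b c x) x y \<noteq> 0" by (rule m_sq_nonzero[OF c xy])
      show "(\<Sum>i\<in>UNIV. b_up (L c) (b c x) x y $ i * cartan_tensor (L c) x y i j k) = 0" for j k
        using bL c xy unfolding b_condition_def by blast
      show "(\<Sum>i\<in>UNIV. b_up (L c) (b c x) x y $ i * cartan_tensor (Lbar c) x y i j k) = 0" for j k
        using bLbar c xy unfolding b_condition_def by blast
    qed (use xy ratio_in_W[OF c] in auto)
  qed
  from ode_quadratic[OF open_all_ratios connected_all_ratios deriv[OF J] this] that
  show thesis unfolding \<psi>_def by blast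
qed

text \<open>
  The constants found by integrating the differential equation are nonzero: \<open>k = 0\<close> would make
  \<open>f(u, -)\<close> locally constant at the given point, and \<open>k' = 0\<close> would make \<open>L'\<^sup>2 = k \<beta>\<^sup>2\<close>
  degenerate.
\<close>

lemma b_condition_bar_imp_energy:
  assumes dim: "CARD('n) > 2" and bL: "b_condition A D b L L" and bLbar: "b_condition A D b L Lbar"
    and dep: "c\<^sub>0 \<in> A" "(x\<^sub>0, y\<^sub>0) \<in> D c\<^sub>0" "pd2 f (L_tilde \<sigma> L c\<^sub>0 x\<^sub>0 y\<^sub>0) (beta b c\<^sub>0 x\<^sub>0 y\<^sub>0) \<noteq> 0"
  shows "energy_beta_change A D L f \<sigma> b"
proof -
  obtain k k' where kk: "\<And>r. r \<in> all_ratios \<Longrightarrow> (f 1 r)\<^sup>2 = k' + k * r\<^sup>2"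
    using b_condition_bar_imp_profile[OF dim bL bLbar] by blast
  have sq: "(Lbar c x y)\<^sup>2 = k' * (factor c x)\<^sup>2 * (L c x y)\<^sup>2 + k * (b c x \<bullet> y)\<^sup>2"
    if "c \<in> A" "(x, y) \<in> D c" for c x y
  proof -
    have "(f 1 (ratio c x y))\<^sup>2 = k' + k * (ratio c x y)\<^sup>2"
      using kk that unfolding all_ratios_def by blast
    then show ?thesis using L_pos[OF that]
      by (simp add: Lbar_eq[OF that] power_mult_distrib beta_slope_def field_simps)
  qed
  have "k \<noteq> 0"
  proof
    assume "k = 0"
    define u where "u = L_tilde \<sigma> L c\<^sub>0 x\<^sub>0 y\<^sub>0"
    define v where "v = beta b c\<^sub>0 x\<^sub>0 y\<^sub>0"
    have u: "u > 0" using L_pos[OF dep(1,2)] by (simp add: u_def L_tilde_def)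
    define V where "V = (\<lambda>t. t / u) -` all_ratios"
    have "open V" unfolding V_def using open_all_ratios u by (intro open_vimage continuous_intros) auto
    moreover have "v / u = ratio c\<^sub>0 x\<^sub>0 y\<^sub>0"
      by (simp add: u_def v_def beta_slope_def L_tilde_def beta_def)
    then have "v \<in> V" unfolding V_def all_ratios_def using dep(1,2) by blast
    moreover have "u * sqrt k' = f u t" if "t \<in> V" for t
    proof -
      have t: "t / u \<in> all_ratios" using that by (simp add: V_def)
      then have "(1, t / u) \<in> W" using ratio_in_W unfolding all_ratios_def by auto
      then have "f u t = u * f 1 (t / u)" using W_cone[of 1 "t / u" u] u by simp
      moreover have "f 1 (t / u) = sqrt k'"
        using kk[OF t] f_pos_all_ratios[OF t] \<open>k = 0\<close> by (metis add.right_neutral mult_zero_left less_imp_le real_sqrt_unique)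
      ultimately show ?thesis by simp
    qed
    ultimately have "((\<lambda>t. f u t) has_real_derivative 0) (at v)"
      using has_field_derivative_transform_within_open[OF DERIV_const] by metis
    then show False using dep(3) by (simp add: pd2_def u_def v_def DERIV_imp_deriv)
  qed
  moreover have "k' \<noteq> 0"
  proof
    assume "k' = 0"
    interpret finsler_fibre "L c\<^sub>0" x\<^sub>0 "fibre c\<^sub>0 x\<^sub>0" by (rule fibre_finsler[OF dep(1) finsler(2)])
    interpret bar: finsler_fibre "Lbar c\<^sub>0" x\<^sub>0 "fibre c\<^sub>0 x\<^sub>0" by (rule fibre_finsler[OF dep(1) finsler_bar])
    let ?b = "b c\<^sub>0 x\<^sub>0"
    have "metric_tensor (Lbar c\<^sub>0) x\<^sub>0 y\<^sub>0 $ i $ j = 0 * metric_tensor (L c\<^sub>0) x\<^sub>0 y\<^sub>0 $ i $ j + k * (?b $ i * ?b $ j)" for i j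
      by (rule metric_and_cartan_of_quadratic_sum(1)[where S = "fibre c\<^sub>0 x\<^sub>0" and L = "L c\<^sub>0" and x = "x\<^sub>0", OF open_S _ E_smooth])
         (use dep sq \<open>k' = 0\<close> in auto)
    then have met: "metric_tensor (Lbar c\<^sub>0) x\<^sub>0 y\<^sub>0 *v Y = (k * (?b \<bullet> Y)) *\<^sub>R ?b" for Y
      by (simp add: vec_eq_iff matrix_vector_mult_def inner_vec_def sum_distrib_left sum_distrib_right mult_ac)
    obtain Y where Y: "Y \<noteq> 0" "?b \<bullet> Y = 0" using exists_nonzero_orthogonal_to_two[OF dim, of ?b ?b] by blast
    then have "metric_tensor (Lbar c\<^sub>0) x\<^sub>0 y\<^sub>0 *v Y = 0" using met by simp
    moreover have "invertible (metric_tensor (Lbar c\<^sub>0) x\<^sub>0 y\<^sub>0)" using bar.nondeg dep by simp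
    ultimately show False
      using Y(1) by (metis matrix_inv_cancel matrix_vector_mul_assoc matrix_vector_mul_lid matrix_vector_mult_0_right)
  qed
  moreover have "Lbar c x y = sqrt (k' * exp (2 * \<sigma> (chart_inv c x)) * (L c x y)\<^sup>2 + k * (beta b c x y)\<^sup>2)"
    if "c \<in> A" "(x, y) \<in> D c" for c x y
    using sq[OF that] Lbar_pos[OF that]
    by (simp add: beta_def exp_double real_sqrt_unique[symmetric])
  ultimately show ?thesis unfolding energy_beta_change_def by blast
qed

lemma energy_imp_b_condition_bar:
  assumes bL: "b_condition A D b L L" and en: "energy_beta_change A D L f \<sigma> b"
  shows "b_condition A D b L Lbar"
proof -
  obtain k k' where en: "\<And>c x y. c \<in> A \<Longrightarrow> (x, y) \<in> D c \<Longrightarrow>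
      Lbar c x y = sqrt (k' * exp (2 * \<sigma> (chart_inv c x)) * (L c x y)\<^sup>2 + k * (beta b c x y)\<^sup>2)"
    using en unfolding energy_beta_change_def by blast
  have "(\<Sum>i\<in>UNIV. b_up (L c) (b c x) x y $ i * cartan_tensor (Lbar c) x y i j l) = 0"
    if c: "c \<in> A" and xy: "(x, y) \<in> D c" for c x y j l
  proof -
    interpret finsler_fibre "L c" x "fibre c x" by (rule fibre_finsler[OF c finsler(2)])
    let ?a = "k' * exp (2 * \<sigma> (chart_inv c x))"
    have "(Lbar c x z)\<^sup>2 = ?a * (L c x z)\<^sup>2 + k * (b c x \<bullet> z)\<^sup>2" if "z \<in> fibre c x" for z
      using en[OF c, of x z] Lbar_pos[OF c, of x z] that by (simp add: beta_def)
    then have "cartan_tensor (Lbar c) x y i j l = ?a * cartan_tensor (L c) x y i j l" for i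
      by (intro metric_and_cartan_of_quadratic_sum(2)[where S = "fibre c x" and L = "L c" and x = x, OF open_S _ E_smooth])
         (use xy in auto)
    then have "(\<Sum>i\<in>UNIV. b_up (L c) (b c x) x y $ i * cartan_tensor (Lbar c) x y i j l)
        = ?a * (\<Sum>i\<in>UNIV. b_up (L c) (b c x) x y $ i * cartan_tensor (L c) x y i j l)"
      by (simp add: sum_distrib_left mult_ac)
    then show ?thesis using bL c xy unfolding b_condition_def by fastforce
  qed
  then show ?thesis unfolding b_condition_def by blast
qed

end

section \<open>The equivalence\<close>

theorem theorem4p1:
  fixes X :: "'a topology"
    and A :: "('a, 'n::finite) chart set"
    and D :: "('a, 'n) chart \<Rightarrow> ((real ^ 'n) \<times> (real ^ 'n)) set"
    and L :: "('a, 'n) chart \<Rightarrow> real ^ 'n \<Rightarrow> real ^ 'n \<Rightarrow> real"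
    and f :: "real \<Rightarrow> real \<Rightarrow> real"
    and W :: "(real \<times> real) set"
    and \<sigma> :: "'a \<Rightarrow> real"
    and b :: "('a, 'n) chart \<Rightarrow> real ^ 'n \<Rightarrow> real ^ 'n"
  assumes dim: "CARD('n) > 2"
    and manifold: "smooth_manifold X A" "connected_space X"
    and finsler: "conic_domain A D" "finsler_structure A D L"
    and change: "generalized_beta_conformal_change A D L f W \<sigma> b"
    and standing: "standing_assumptions A D L f \<sigma> b"
    and b_cond: "b_condition A D b L L"
    and depends_on_beta:
      "\<exists>c\<in>A. \<exists>(x, y)\<in>D c. pd2 f (L_tilde \<sigma> L c x y) (beta b c x y) \<noteq> 0"
  shows "b_condition_invariant A D L f \<sigma> b \<longleftrightarrow> energy_beta_change A D L f \<sigma> b"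
proof -
  interpret beta_change X A D L f W \<sigma> b
    by unfold_locales (fact manifold finsler change standing)+
  obtain c x y where "c \<in> A" "(x, y) \<in> D c" "pd2 f (L_tilde \<sigma> L c x y) (beta b c x y) \<noteq> 0"
    using depends_on_beta by blast
  then show ?thesis
    using b_condition_bar_imp_energy[OF dim b_cond] energy_imp_b_condition_bar[OF b_cond] b_cond
    unfolding b_condition_invariant_def by blast
qed

end
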